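(* Let $p$ be a prime, let $F$ be a finite extension of $\mathbb{Q}_p$, and let $C$ be an algebraic closure of $\mathbb{Q}_p$ with its $p$-adic absolute value. Let $\mathcal{S}$ be the space of locally constant, compactly supported functions $F\to C$, equipped with the sup norm $\|\phi\|=\sup_{x\in F}|\phi(x)|$, and let $\mathcal{F}:\mathcal{S}\to\mathcal{S}$ be the Fourier transform. Then for every $\phi\in\mathcal{S}$ there is a sequence $\phi_n\in\mathcal{S}$ such that $\phi_n\to\phi$ uniformly (i.e. $\|\phi_n-\phi\|\to 0$) and $\mathcal{F}(\phi_n)\to 0$ uniformly (i.e. $\|\mathcal{F}(\phi_n)\|\to 0$).
   Context: The $p$-adic absolute value on $C$ is normalized by $|p|=p^{-1}$. Let $\mathcal{O}_F$ be the ring of integers of $F$. Fix an additive character $\psi:F\to C^\times$ (locally constant homomorphism) such that $\mathcal{O}_F$ is equal to its own annihilator under the pairing $\langle x,y\rangle=\psi(xy)$. Let $dx$ be the unique $C$-valued translation-invariant finitely additive distribution on compact open subsets of $F$ assigning measure $1$ to $\mathcal{O}_F$. The Fourier transform of $\phi\in\mathcal{S}$ is $\mathcal{F}(\phi)(x)=\int_F\phi(y)\psi(xy)\,dy$, which again lies in $\mathcal{S}$. *)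

theory Defs
  imports "HOL-Analysis.Analysis" "HOL-Computational_Algebra.Computational_Algebra"
begin

text \<open>
  A field with a multiplicative non-archimedean absolute value, carrying the metric and the
  topology of that absolute value. The class \<^class>\<open>real_normed_field\<close> is not usable
  here, since its members are algebras over the real numbers. That \<open>vabs\<close> is nonnegative and
  vanishes only at zero follows from the metric axioms and \<open>dist_vabs\<close>.
\<close>

class nonarch_valued_field = field + metric_space +
  fixes vabs :: "'a \<Rightarrow> real"
  assumes dist_vabs: "dist x y = vabs (x - y)"
    and vabs_mult: "vabs (x * y) = vabs x * vabs y"
    and vabs_ultrametric: "vabs (x + y) \<le> max (vabs x) (vabs y)"

definition rat_padic_abs :: "nat \<Rightarrow> rat \<Rightarrow> real" where
  "rat_padic_abs p r =
     (if r = 0 then 0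
      else real p powi (int (multiplicity (int p) (snd (quotient_of r)))
                        - int (multiplicity (int p) (fst (quotient_of r)))))"

text \<open>
  The field of \<open>p\<close>-adic numbers is the completion of the rational numbers with respect to the
  \<open>p\<close>-adic absolute value, which determines it up to a unique isometric isomorphism. The
  predicate says that the given type is such a completion.
\<close>

definition is_padic_field :: "nat \<Rightarrow> 'q::{nonarch_valued_field, field_char_0} itself \<Rightarrow> bool" where
  "is_padic_field p _ \<longleftrightarrow>
     (\<forall>r. vabs (of_rat r :: 'q) = rat_padic_abs p r) \<and>
     closure (range (of_rat :: rat \<Rightarrow> 'q)) = UNIV \<and>
     complete (UNIV :: 'q set)"

definition valued_field_embedding ::
    "('k::nonarch_valued_field \<Rightarrow> 'l::nonarch_valued_field) \<Rightarrow> bool" where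
  "valued_field_embedding \<iota> \<longleftrightarrow>
     \<iota> 1 = 1 \<and>
     (\<forall>x y. \<iota> (x + y) = \<iota> x + \<iota> y) \<and>
     (\<forall>x y. \<iota> (x * y) = \<iota> x * \<iota> y) \<and>
     (\<forall>x. vabs (\<iota> x) = vabs x)"

text \<open>
  The absolute value of a complete valued field extends in exactly one way to any algebraic
  extension. Hence in both definitions below the absolute value of the larger field is no
  additional choice: it is the only one for which the embedding is isometric.
\<close>

definition finite_valued_extension ::
    "('k::nonarch_valued_field \<Rightarrow> 'l::nonarch_valued_field) \<Rightarrow> bool" where
  "finite_valued_extension \<iota> \<longleftrightarrow>
     valued_field_embedding \<iota> \<and>
     (\<exists>B. finite_dimensional_vector_space (\<lambda>a x. \<iota> a * x) B)"

definition valued_algebraic_closure ::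
    "('k::nonarch_valued_field \<Rightarrow> 'l::{nonarch_valued_field, alg_closed_field}) \<Rightarrow> bool" where
  "valued_algebraic_closure \<iota> \<longleftrightarrow>
     valued_field_embedding \<iota> \<and>
     (\<forall>x. \<exists>P. P \<noteq> 0 \<and> poly (map_poly \<iota> P) x = 0)"

definition ring_of_integers :: "'f::nonarch_valued_field set" where
  "ring_of_integers = {x. vabs x \<le> 1}"

definition loc_const :: "('a::topological_space \<Rightarrow> 'b) \<Rightarrow> bool" where
  "loc_const f \<longleftrightarrow> (\<forall>x. \<exists>U. open U \<and> x \<in> U \<and> f constant_on U)"

definition schwartz_space :: "('f::nonarch_valued_field \<Rightarrow> 'c::nonarch_valued_field) set" where
  "schwartz_space = {\<phi>. loc_const \<phi> \<and> compact (closure {x. \<phi> x \<noteq> 0})}"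

definition sup_norm :: "('f \<Rightarrow> 'c::nonarch_valued_field) \<Rightarrow> real" where
  "sup_norm \<phi> = (SUP x. vabs (\<phi> x))"

definition additive_character ::
    "('f::nonarch_valued_field \<Rightarrow> 'c::nonarch_valued_field) \<Rightarrow> bool" where
  "additive_character \<psi> \<longleftrightarrow>
     (\<forall>x. \<psi> x \<noteq> 0) \<and> (\<forall>x y. \<psi> (x + y) = \<psi> x * \<psi> y) \<and> loc_const \<psi>"

definition annihilator :: "('f::nonarch_valued_field \<Rightarrow> 'c::nonarch_valued_field) \<Rightarrow> 'f set \<Rightarrow> 'f set" where
  "annihilator \<psi> A = {x. \<forall>y\<in>A. \<psi> (x * y) = 1}"

text \<open>Only the values of \<open>\<mu>\<close> on compact open sets are meaningful.\<close>

definition normalized_haar_distribution ::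
    "('f::nonarch_valued_field set \<Rightarrow> 'c::nonarch_valued_field) \<Rightarrow> bool" where
  "normalized_haar_distribution \<mu> \<longleftrightarrow>
     (\<forall>A B. compact A \<and> open A \<and> compact B \<and> open B \<and> A \<inter> B = {} \<longrightarrow> \<mu> (A \<union> B) = \<mu> A + \<mu> B) \<and>
     (\<forall>a A. compact A \<and> open A \<longrightarrow> \<mu> ((+) a ` A) = \<mu> A) \<and>
     \<mu> ring_of_integers = 1"

text \<open>
  A locally constant function of compact support has finite range, and its fibres over nonzero
  values are compact open, so its integral against a finitely additive distribution is the finite
  sum below.
\<close>

definition distr_integral ::
    "('f set \<Rightarrow> 'c::nonarch_valued_field) \<Rightarrow> ('f \<Rightarrow> 'c) \<Rightarrow> 'c" where
  "distr_integral \<mu> \<phi> = (\<Sum>c\<in>range \<phi> - {0}. c * \<mu> (\<phi> -` {c}))"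

definition fourier_transform ::
    "('f::nonarch_valued_field set \<Rightarrow> 'c::nonarch_valued_field) \<Rightarrow> ('f \<Rightarrow> 'c) \<Rightarrow> ('f \<Rightarrow> 'c) \<Rightarrow> 'f \<Rightarrow> 'c" where
  "fourier_transform \<mu> \<psi> \<phi> x = distr_integral \<mu> (\<lambda>y. \<phi> y * \<psi> (x * y))"

end

theory Submission
  imports Defs "HOL-Number_Theory.Cong"
begin

text \<open>
  Write \<open>O\<close> for the ring of integers of \<open>F\<close>. The Fourier transform of the indicator function of
  \<open>p\<^bsup>-M\<^esup>O\<close> is \<open>p\<close>-adically tiny, of size at most \<open>p\<^bsup>-M\<^esup>\<close>, and multiplication by a character of \<open>F\<close>
  translates the transform. So a linear combination \<open>\<Theta>\<close> of characters, restricted to \<open>p\<^bsup>-M\<^esup>O\<close>, has a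
  small transform as soon as its coefficients are small compared to \<open>p\<^sup>M\<close>. The indicator of \<open>p\<^sup>nO\<close> in
  \<open>p\<^bsup>-M\<^esup>O\<close> is such a combination, but its coefficients have size at least \<open>p\<^bsup>n+M\<^esup>\<close>. One obtains much
  smaller ones, of size at most \<open>p\<^bsup>N/2\<^esup>\<close> with \<open>N = n + M\<close>, by being content with an error \<open>r < 1\<close>
  independent of \<open>M\<close>: if \<open>\<zeta>\<close> is a primitive root of unity of order \<open>p\<^bsup>N+c\<^esup>\<close>, the polynomial
  \<open>\<theta>(x) = \<Prod>(x - \<zeta>\<^sup>i) / (1 - \<zeta>\<^sup>i)\<close> over \<open>0 < i < p\<^sup>N\<close> is within \<open>r\<close> of \<open>1\<close> on the roots of unity of order
  dividing \<open>p\<^sup>c\<close> and within \<open>r\<close> of \<open>0\<close> on all other powers of \<open>\<zeta>\<close>, and \<open>\<Theta>\<close> is a product of functions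
  \<open>\<theta>(\<psi>(b y))\<close>, one for each coset of \<open>pO\<close> in \<open>O\<close>. Hence every Schwartz function is, up to an error of
  relative size \<open>r\<close>, a Schwartz function with arbitrarily small transform, and iteration makes the
  error as small as desired.
\<close>

section \<open>Non-archimedean absolute values\<close>

lemma vabs_nonneg [simp]: "vabs (x::'a::nonarch_valued_field) \<ge> 0"
  using zero_le_dist[of x 0] by (simp add: dist_vabs)

lemma vabs_eq_0_iff [simp]: "vabs (x::'a::nonarch_valued_field) = 0 \<longleftrightarrow> x = 0"
  using dist_eq_0_iff[of x 0] by (simp add: dist_vabs)

lemma vabs_0 [simp]: "vabs (0::'a::nonarch_valued_field) = 0"
  by simp

lemma vabs_pos_iff [simp]: "vabs (x::'a::nonarch_valued_field) > 0 \<longleftrightarrow> x \<noteq> 0"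
  using vabs_nonneg[of x] vabs_eq_0_iff[of x] by linarith

lemma vabs_1 [simp]: "vabs (1::'a::nonarch_valued_field) = 1"
  using vabs_mult[of "1::'a" 1] by simp

lemma vabs_minus_commute: "vabs (x - y) = vabs (y - x :: 'a::nonarch_valued_field)"
  by (metis dist_commute dist_vabs)

lemma vabs_minus [simp]: "vabs (- x) = vabs (x::'a::nonarch_valued_field)"
  using vabs_minus_commute[of 0 x] by simp

lemma vabs_power: "vabs (x ^ n) = vabs (x::'a::nonarch_valued_field) ^ n"
  by (induction n) (auto simp: vabs_mult)

lemma vabs_prod: "vabs (prod f A) = (\<Prod>i\<in>A. vabs (f i :: 'a::nonarch_valued_field))"
  by (induction A rule: infinite_finite_induct) (auto simp: vabs_mult)

lemma vabs_divide: "vabs (x / y) = vabs x / vabs (y::'a::nonarch_valued_field)"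
proof (cases "y = 0")
  case False
  then have "vabs (x / y) * vabs y = vabs x"
    by (metis nonzero_eq_divide_eq vabs_mult)
  with False show ?thesis by (simp add: field_simps)
qed auto

lemma vabs_add_le:
  assumes "vabs x \<le> B" "vabs (y::'a::nonarch_valued_field) \<le> B"
  shows "vabs (x + y) \<le> B"
  using vabs_ultrametric[of x y] assms by linarith

lemma vabs_diff_le:
  assumes "vabs x \<le> B" "vabs (y::'a::nonarch_valued_field) \<le> B"
  shows "vabs (x - y) \<le> B"
  using vabs_add_le[of x B "- y"] assms by simp

lemma vabs_sum_le:
  assumes "\<And>i. i \<in> A \<Longrightarrow> vabs (f i :: 'a::nonarch_valued_field) \<le> B" "0 \<le> B"
  shows "vabs (sum f A) \<le> B"
  using assms by (induction A rule: infinite_finite_induct) (auto intro: vabs_add_le)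

lemma vabs_of_nat_le: "vabs (of_nat n :: 'a::nonarch_valued_field) \<le> 1"
  by (induction n) (auto intro: vabs_add_le)

text \<open>The isosceles triangle principle: applying the ultrametric inequality to
  \<open>y = (x + y) - x\<close> shows that a strictly smaller summand cannot cause
  cancellation.\<close>

lemma vabs_add_eq:
  assumes "vabs x < vabs (y::'a::nonarch_valued_field)"
  shows "vabs (x + y) = vabs y"
proof (rule antisym)
  show "vabs (x + y) \<le> vabs y" using assms by (intro vabs_add_le) auto
  show "vabs y \<le> vabs (x + y)"
    using vabs_ultrametric[of "x + y" "- x"] assms by auto
qed

text \<open>Products of elements close to 1 stay equally close:
  \<open>f g - 1 = (f - 1) g + (g - 1)\<close>, and a product within \<open>r \<le> 1\<close> of 1
  has absolute value at most 1.\<close>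

lemma vabs_prod_diff_1_le:
  assumes "\<And>i. i \<in> A \<Longrightarrow> vabs (f i - 1 :: 'a::nonarch_valued_field) \<le> r" "0 \<le> r" "r \<le> 1"
  shows "vabs (prod f A - 1) \<le> r"
  using assms(1)
proof (induction A rule: infinite_finite_induct)
  case (insert i A)
  have *: "f i * prod f A - 1 = (f i - 1) * prod f A + (prod f A - 1)"
    by (simp add: algebra_simps)
  have le: "vabs (prod f A - 1) \<le> r" using insert by auto
  have "vabs (prod f A) \<le> 1"
    using vabs_add_le[of "prod f A - 1" 1 1] le assms(3) by simp
  then have "vabs (f i - 1) * vabs (prod f A) \<le> r * 1"
    using insert(4)[of i] assms(2) by (intro mult_mono) auto
  then have "vabs (f i * prod f A - 1) \<le> r"
    unfolding * by (intro vabs_add_le le) (auto simp: vabs_mult)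
  with insert show ?case by simp
qed (use assms in auto)

section \<open>Roots of unity of \<open>p\<close>-power order\<close>

text \<open>Both sides are monic of degree \<open>m\<close>, so a nonzero difference would have
  degree below \<open>m\<close>; yet it vanishes at the \<open>m\<close> distinct powers of
  \<open>\<zeta>\<close>.\<close>

lemma prod_linear_factors_roots_of_unity:
  fixes \<zeta> :: "'a::field"
  assumes "\<zeta> ^ m = 1" "inj_on (\<lambda>i. \<zeta> ^ i) {..<m}" "m > 0"
  shows "(\<Prod>i<m. [:- (\<zeta> ^ i), 1:]) = monom 1 m - 1"
proof (rule ccontr)
  define A where "A = (\<Prod>i<m. [:- (\<zeta> ^ i), 1:])"
  define B where "B = (monom 1 m - 1 :: 'a poly)"
  assume "(\<Prod>i<m. [:- (\<zeta> ^ i), 1:]) \<noteq> monom 1 m - 1"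
  then have ne: "A - B \<noteq> 0" by (simp add: A_def B_def)
  have degA: "degree A = m" unfolding A_def
    by (subst degree_prod_eq_sum_degree) auto
  have "lead_coeff A = 1" unfolding A_def by (simp add: lead_coeff_prod)
  then have lcA: "coeff A m = 1" using degA by simp
  have degB: "degree B \<le> m" unfolding B_def
    by (intro degree_diff_le) (auto simp: degree_monom_le)
  have lcB: "coeff B m = 1" using assms(3) unfolding B_def by (cases m) (auto simp: one_pCons)
  have deg: "degree (A - B) < m"
  proof -
    have "degree (A - B) \<le> m" using degA degB by (intro degree_diff_le) auto
    moreover have "coeff (A - B) m = 0" using lcA lcB by simp
    ultimately show ?thesis using ne
      by (metis le_neq_implies_less leading_coeff_0_iff)
  qed
  have "(\<lambda>i. \<zeta> ^ i) ` {..<m} \<subseteq> {x. poly (A - B) x = 0}"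
  proof clarify
    fix i assume "i < m"
    have "poly A (\<zeta> ^ i) = 0" using \<open>i < m\<close> unfolding A_def by (auto simp: poly_prod)
    moreover have "poly B (\<zeta> ^ i) = 0" unfolding B_def
      using assms(1) by (simp add: poly_monom flip: power_mult) (metis mult.commute power_mult power_one)
    ultimately show "poly (A - B) (\<zeta> ^ i) = 0" by simp
  qed
  then have "card ((\<lambda>i. \<zeta> ^ i) ` {..<m}) \<le> card {x. poly (A - B) x = 0}"
    by (intro card_mono poly_roots_finite ne)
  also have "\<dots> \<le> degree (A - B)" by (rule card_poly_roots_bound[OF ne])
  finally show False using deg assms(2) by (simp add: card_image)
qed

lemma root_of_unity_is_power:
  fixes \<zeta> :: "'a::field"
  assumes "\<zeta> ^ m = 1" "inj_on (\<lambda>i. \<zeta> ^ i) {..<m}" "m > 0" "x ^ m = 1"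
  obtains j where "j < m" "x = \<zeta> ^ j"
proof -
  have "poly (\<Prod>i<m. [:- (\<zeta> ^ i), 1:]) x = 0"
    unfolding prod_linear_factors_roots_of_unity[OF assms(1-3)] using assms(4) by (simp add: poly_monom)
  then show ?thesis using that by (auto simp: poly_prod)
qed

text \<open>Cancel the factor \<open>X - 1\<close> from the factorisation of \<open>X^m - 1\<close>
  and evaluate the quotient \<open>1 + X + ... + X^(m-1)\<close> at 1.\<close>

lemma prod_one_minus_roots_of_unity:
  fixes \<zeta> :: "'a::field"
  assumes "\<zeta> ^ m = 1" "inj_on (\<lambda>i. \<zeta> ^ i) {..<m}" "m > 0"
  shows "(\<Prod>i\<in>{1..<m}. 1 - \<zeta> ^ i) = of_nat m"
proof -
  have "monom 1 m - 1 = [:-1, 1:] * (\<Sum>i<m. monom (1::'a) i)"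
  proof -
    have "(monom 1 1 :: 'a poly) ^ m - 1 = (monom 1 1 - 1) * (\<Sum>i<m. monom 1 1 ^ i)"
      by (rule power_diff_1_eq)
    then show ?thesis by (simp add: monom_power monom_altdef one_pCons)
  qed
  moreover have "{..<m} = insert 0 {1..<m}" using assms(3) by auto
  then have "(\<Prod>i<m. [:- (\<zeta> ^ i), 1:]) = [:-1, 1:] * (\<Prod>i\<in>{1..<m}. [:- (\<zeta> ^ i), 1:])"
    by simp
  ultimately have "(\<Prod>i\<in>{1..<m}. [:- (\<zeta> ^ i), 1:]) = (\<Sum>i<m. monom (1::'a) i)"
    using prod_linear_factors_roots_of_unity[OF assms] by (metis mult_left_cancel pCons_eq_0_iff one_neq_zero)
  then have "poly (\<Prod>i\<in>{1..<m}. [:- (\<zeta> ^ i), 1:]) 1 = poly (\<Sum>i<m. monom (1::'a) i) 1" by simp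
  then show ?thesis by (simp add: poly_prod poly_sum poly_monom)
qed

definition primitive_root_of_unity :: "nat \<Rightarrow> 'a::field \<Rightarrow> bool" where
  "primitive_root_of_unity m \<zeta> \<longleftrightarrow> (\<forall>i. \<zeta> ^ i = 1 \<longleftrightarrow> m dvd i)"

lemma primitive_root_of_unity_inj_on:
  fixes \<zeta> :: "'a::field"
  assumes "primitive_root_of_unity m \<zeta>" "m > 0"
  shows "inj_on (\<lambda>i. \<zeta> ^ i) {..<m}"
proof -
  have nz: "\<zeta> \<noteq> 0"
    using assms unfolding primitive_root_of_unity_def by (metis dvd_refl power_0_left neq0_conv zero_neq_one)
  have "i = j" if "i \<le> j" "j < m" "\<zeta> ^ i = \<zeta> ^ j" for i j
  proof -
    have "\<zeta> ^ (j - i) = 1" using that nz by (simp add: power_diff)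
    then have "m dvd j - i" using assms(1) unfolding primitive_root_of_unity_def by blast
    then show ?thesis using that by (metis diff_is_0_eq dvd_imp_le le_antisym less_imp_diff_less neq0_conv not_less)
  qed
  then show ?thesis unfolding inj_on_def by (metis lessThan_iff nat_le_linear)
qed

text \<open>If \<open>\<zeta> ^ i = 1\<close>, Bezout gives \<open>\<zeta> ^ gcd i m = 1\<close>.
  This gcd is a power of \<open>p\<close>, and unless it is all of \<open>m\<close> it divides
  \<open>p ^ l\<close>, against the second assumption.\<close>

lemma primitive_root_of_unity_prime_powerI:
  fixes \<zeta> :: "'a::field"
  assumes p: "prime p" and one: "\<zeta> ^ (p ^ Suc l) = 1" and ne: "\<zeta> ^ (p ^ l) \<noteq> 1"
  shows "primitive_root_of_unity (p ^ Suc l) \<zeta>"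
proof -
  define m where "m = p ^ Suc l"
  have 1: "\<zeta> ^ m = 1" using one by (simp add: m_def)
  have "m dvd i" if i: "\<zeta> ^ i = 1" for i
  proof (rule ccontr)
    assume nd: "\<not> m dvd i"
    obtain a where a: "gcd i m = p ^ a" "a \<le> Suc l"
      using divides_primepow_nat[OF p, of "gcd i m" "Suc l"] by (auto simp: m_def)
    have "a \<noteq> Suc l" using a nd by (metis gcd_dvd1 m_def)
    then have "a \<le> l" using a by simp
    obtain x where x: "[i * x = p ^ a] (mod m)" using cong_solve_nat[of i m] a by auto
    have red: "\<zeta> ^ u = \<zeta> ^ (u mod m)" for u
    proof -
      have "\<zeta> ^ u = \<zeta> ^ (m * (u div m) + u mod m)" by simp
      then show ?thesis unfolding power_add power_mult 1 by simp
    qed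
    have "\<zeta> ^ (p ^ a) = \<zeta> ^ (i * x)"
      using red[of "p ^ a"] red[of "i * x"] x by (simp add: cong_def)
    also have "\<dots> = 1" by (simp add: power_mult i)
    finally have "\<zeta> ^ (p ^ l) = 1" using \<open>a \<le> l\<close>
      by (metis le_imp_power_dvd dvdE power_mult power_one)
    then show False using ne by simp
  qed
  moreover have "\<zeta> ^ i = 1" if "m dvd i" for i
    using that 1 by (auto simp: power_mult)
  ultimately show ?thesis unfolding primitive_root_of_unity_def m_def by blast
qed

text \<open>A root \<open>w\<close> of \<open>1 + X + ... + X^(p-1)\<close> satisfies
  \<open>w ^ p = 1\<close>, and \<open>w \<noteq> 1\<close> because the value at 1 is
  \<open>p\<close>, which is nonzero. Any \<open>p ^ l\<close>-th root of \<open>w\<close> then has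
  order \<open>p ^ Suc l\<close>.\<close>

lemma ex_primitive_root_of_unity_prime_power:
  fixes p :: nat
  assumes p: "prime p" and p0: "of_nat p \<noteq> (0 :: 'a::alg_closed_field)"
  obtains \<zeta> :: "'a::alg_closed_field" where "primitive_root_of_unity (p ^ k) \<zeta>"
proof (cases k)
  case 0
  then show ?thesis using that[of 1] by (simp add: primitive_root_of_unity_def)
next
  case (Suc l)
  define P where "P = (\<Sum>i<p. monom (1::'a) i)"
  have cP: "coeff P i = (if i < p then 1 else 0)" for i
    unfolding P_def by (auto simp: coeff_sum)
  have "degree P > 0"
    using cP[of 1] prime_gt_1_nat[OF p] le_degree[of P 1] by simp
  then obtain w where w: "poly P w = 0" using alg_closed_imp_poly_has_root by blast
  obtain \<zeta> where z: "\<zeta> ^ (p ^ l) = w"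
    using nth_root_exists[of "p ^ l" w] prime_gt_0_nat[OF p] by auto
  have "(w - 1) * poly P w = w ^ p - 1"
    unfolding P_def by (simp add: poly_sum poly_monom power_diff_1_eq)
  then have wp: "w ^ p = 1" using w by simp
  have w1: "w \<noteq> 1"
  proof
    assume "w = 1"
    then have "poly P w = of_nat p" unfolding P_def by (simp add: poly_sum poly_monom)
    then show False using w p0 by simp
  qed
  have "\<zeta> ^ (p ^ Suc l) = 1" using wp by (simp add: mult.commute[of p] power_mult z)
  then show ?thesis
    using that primitive_root_of_unity_prime_powerI[OF p, of \<zeta> l] w1 z Suc by simp
qed

lemma vabs_root_of_unity:
  fixes x :: "'a::nonarch_valued_field"
  assumes "x ^ m = 1" "m > 0"
  shows "vabs x = 1"
proof -
  have "vabs x ^ m = 1 ^ m" using assms(1) by (metis power_one vabs_1 vabs_power)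
  then show ?thesis using assms(2) by (metis power_eq_imp_eq_base vabs_nonneg zero_le_one)
qed

section \<open>Distances between 1 and roots of unity of p-power order\<close>

lemma vabs_power_minus_1_le:
  fixes x :: "'a::nonarch_valued_field"
  assumes "vabs x \<le> 1"
  shows "vabs (x ^ n - 1) \<le> vabs (x - 1)"
proof -
  have "vabs (\<Sum>i<n. x ^ i) \<le> 1"
    using assms by (intro vabs_sum_le) (auto simp: vabs_power power_le_one)
  then have "vabs (x - 1) * vabs (\<Sum>i<n. x ^ i) \<le> vabs (x - 1) * 1"
    by (intro mult_left_mono) auto
  then show ?thesis by (simp add: power_diff_1_eq vabs_mult)
qed

text \<open>With \<open>t = x - 1\<close>, the binomial theorem gives
  \<open>x ^ p - 1 = t ^ p\<close> up to terms divisible by \<open>p\<close>.\<close>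

lemma vabs_minus_1_prime_power_le:
  fixes x :: "'a::nonarch_valued_field"
  assumes p: "prime p" and vp: "vabs (of_nat p :: 'a) = 1 / p" and x: "vabs x \<le> 1"
  shows "vabs (x - 1) ^ p \<le> max (vabs (x ^ p - 1)) (1 / p)"
proof -
  define t where "t = x - 1"
  have t: "vabs t \<le> 1" unfolding t_def using x by (intro vabs_diff_le) auto
  have p1: "p > 1" using p by (rule prime_gt_1_nat)
  have "{..p} = insert 0 (insert p {1..<p})" using p1 by auto
  then have "x ^ p = (\<Sum>k\<in>insert 0 (insert p {1..<p}). of_nat (p choose k) * t ^ k)"
    using binomial_ring[of t 1 p] by (simp add: t_def)
  also have "\<dots> = 1 + (t ^ p + (\<Sum>k\<in>{1..<p}. of_nat (p choose k) * t ^ k))"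
    using p1 by simp
  finally have eq: "t ^ p = (x ^ p - 1) - (\<Sum>k\<in>{1..<p}. of_nat (p choose k) * t ^ k)" by simp
  have "vabs (\<Sum>k\<in>{1..<p}. of_nat (p choose k) * t ^ k) \<le> 1 / p"
  proof (rule vabs_sum_le)
    fix k assume "k \<in> {1..<p}"
    then have "p dvd (p choose k)" using p by (intro dvd_choose_prime) auto
    then obtain m where m: "(p choose k) = p * m" by blast
    have "vabs (of_nat (p choose k) * t ^ k) = 1 / p * (vabs (of_nat m :: 'a) * vabs t ^ k)"
      by (simp add: m vabs_mult vabs_power vp)
    also have "\<dots> \<le> 1 / p * (1 * 1)"
      using t by (intro mult_left_mono mult_mono power_le_one vabs_of_nat_le) auto
    finally show "vabs (of_nat (p choose k) * t ^ k) \<le> 1 / p" by simp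
  qed auto
  then have "vabs (t ^ p) \<le> max (vabs (x ^ p - 1)) (1 / p)"
    unfolding eq by - (rule vabs_diff_le, auto)
  then show ?thesis by (simp add: t_def vabs_power)
qed

text \<open>Induction on \<open>k\<close>, passing from \<open>x\<close> to \<open>x ^ p\<close>.
  The bound depends on the order of \<open>x\<close> alone, which is what later makes the error
  \<open>r\<close> uniform.\<close>

lemma vabs_root_of_unity_minus_1_power_le:
  fixes x :: "'a::nonarch_valued_field"
  assumes p: "prime p" and vp: "vabs (of_nat p :: 'a) = 1 / p" and x: "x ^ (p ^ k) = 1"
  shows "vabs (x - 1) ^ (p ^ k) \<le> 1 / p"
  using x
proof (induction k arbitrary: x)
  case (Suc k)
  have p1: "p > 1" using p by (rule prime_gt_1_nat)
  have "vabs x \<le> 1" using vabs_root_of_unity[OF Suc.prems] p1 by simp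
  then have "vabs (x - 1) ^ p \<le> max (vabs (x ^ p - 1)) (1 / p)"
    by (rule vabs_minus_1_prime_power_le[OF p vp])
  then have "(vabs (x - 1) ^ p) ^ (p ^ k) \<le> (max (vabs (x ^ p - 1)) (1 / p)) ^ (p ^ k)"
    by (intro power_mono) auto
  also have "\<dots> \<le> 1 / p"
  proof -
    have "vabs (x ^ p - 1) ^ (p ^ k) \<le> 1 / p" using Suc by (simp add: power_mult)
    moreover have "(1 / real p) ^ (p ^ k) \<le> (1 / real p) ^ 1"
      using p1 by (intro power_decreasing) auto
    ultimately show ?thesis by (auto simp: max_def)
  qed
  finally show ?case by (simp add: power_mult)
qed auto

text \<open>Powers of \<open>\<zeta>\<close> with exponent divisible by \<open>p ^ N\<close> are the
  inner roots, of order dividing \<open>p ^ c\<close>; all others are outer. The number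
  \<open>r\<close> is the \<open>p ^ Suc c\<close>-th root of \<open>1 / p\<close>, so it depends on
  \<open>c\<close> but not on \<open>N\<close>.\<close>

locale prime_power_root_of_unity =
  fixes p N c :: nat and \<zeta> :: "'c::nonarch_valued_field" and r :: real
  assumes p: "prime p" and vp: "vabs (of_nat p :: 'c) = 1 / p"
    and N: "N \<ge> 1" and prim: "primitive_root_of_unity (p ^ (N + c)) \<zeta>"
    and r: "r \<ge> 0" "r ^ (p ^ Suc c) = 1 / p"
begin

lemma p_gt_1: "p > 1"
  using p by (rule prime_gt_1_nat)

lemma r_less_1: "r < 1"
proof (rule ccontr)
  assume "\<not> r < 1"
  then have "1 \<le> r ^ (p ^ Suc c)" by (intro one_le_power) simp
  then show False using r(2) p_gt_1 by simp
qed

lemma inverse_p_le_r: "1 / p \<le> r"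
proof -
  have "r ^ (p ^ Suc c) \<le> r ^ 1"
    using r(1) r_less_1 p_gt_1 by (intro power_decreasing) auto
  then show ?thesis using r(2) by simp
qed

lemma root_power: "\<zeta> ^ i = 1 \<longleftrightarrow> p ^ (N + c) dvd i"
  using prim by (simp add: primitive_root_of_unity_def)

lemma vabs_root [simp]: "vabs \<zeta> = 1"
  using root_power[of "p ^ (N + c)"] p_gt_1 by (intro vabs_root_of_unity[of _ "p ^ (N + c)"]) simp_all

lemma root_nonzero [simp]: "\<zeta> \<noteq> 0"
  using vabs_root by fastforce

lemma root_power_cong:
  assumes "[i = j] (mod p ^ (N + c))"
  shows "\<zeta> ^ i = \<zeta> ^ j"
proof -
  define n where "n = p ^ (N + c)"
  have 1: "\<zeta> ^ n = 1" by (simp add: root_power n_def)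
  have "\<zeta> ^ u = \<zeta> ^ (u mod n)" for u
  proof -
    have "\<zeta> ^ u = \<zeta> ^ (n * (u div n) + u mod n)" by simp
    then show ?thesis unfolding power_add power_mult 1 by simp
  qed
  from this[of i] this[of j] show ?thesis using assms by (simp add: cong_def n_def)
qed

text \<open>Inner roots are closer to 1 than outer ones by the factor \<open>r\<close>. The root
  \<open>\<eta>\<close> is a power of every outer root, so \<open>\<eta> - 1\<close> is no larger
  than \<open>\<zeta> ^ i - 1\<close>; and every inner root is a power of \<open>\<eta> ^ p\<close>,
  where \<open>\<eta> ^ p - 1\<close> is \<open>\<eta> - 1\<close> times a sum congruent to
  \<open>p\<close> modulo \<open>\<eta> - 1\<close>, hence of size at most \<open>r\<close>.\<close>

lemma inner_outer_roots:
  assumes "\<not> p ^ N dvd i"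
  shows "vabs (\<zeta> ^ (p ^ N * l) - 1) \<le> r * vabs (\<zeta> ^ i - 1)"
proof -
  define \<eta> where "\<eta> = \<zeta> ^ (p ^ (N - 1))"
  have NN: "p ^ N = p ^ (N - 1) * p" using N by (metis power_minus_mult less_le_trans zero_less_one)
  have v1: "vabs \<eta> = 1" by (simp add: \<eta>_def vabs_power)
  \<comment> \<open>Since \<open>a < N\<close>, Bezout makes \<open>p ^ (N - 1)\<close> a multiple
    of \<open>i\<close> modulo the order of \<open>\<zeta>\<close>, so \<open>\<eta>\<close> is a
    power of \<open>\<zeta> ^ i\<close>.\<close>
  obtain a where a: "gcd i (p ^ (N + c)) = p ^ a"
    using divides_primepow_nat[OF p, of "gcd i (p ^ (N + c))" "N + c"] by auto
  have "a < N" using assms a by (metis gcd_dvd1 dvd_trans le_imp_power_dvd not_less)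
  obtain w where "[i * w = p ^ a] (mod p ^ (N + c))" using cong_solve_nat[of i "p ^ (N + c)"] a by auto
  then have "[i * w * p ^ (N - 1 - a) = p ^ a * p ^ (N - 1 - a)] (mod p ^ (N + c))"
    by (intro cong_mult cong_refl)
  also have "p ^ a * p ^ (N - 1 - a) = p ^ (N - 1)"
    using \<open>a < N\<close> by (simp flip: power_add)
  finally have "\<eta> = \<zeta> ^ (i * w * p ^ (N - 1 - a))"
    unfolding \<eta>_def by (metis root_power_cong)
  then have "\<eta> = (\<zeta> ^ i) ^ (w * p ^ (N - 1 - a))" by (simp add: mult.assoc flip: power_mult)
  then have \<eta>_le: "vabs (\<eta> - 1) \<le> vabs (\<zeta> ^ i - 1)"
    using vabs_power_minus_1_le[of "\<zeta> ^ i"] by (simp add: vabs_power)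
  have \<eta>1: "\<eta> ^ (p ^ Suc c) = 1"
  proof -
    have "N - 1 + Suc c = N + c" using N by simp
    then have "p ^ (N - 1) * p ^ Suc c = p ^ (N + c)" by (metis power_add)
    then show ?thesis using root_power by (simp add: \<eta>_def flip: power_mult)
  qed
  have "vabs (\<eta> - 1) ^ (p ^ Suc c) \<le> r ^ (p ^ Suc c)"
    unfolding r(2) by (rule vabs_root_of_unity_minus_1_power_le[OF p vp \<eta>1])
  then have \<eta>_r: "vabs (\<eta> - 1) \<le> r"
    using r(1) p_gt_1 by (metis power_mono_iff vabs_nonneg zero_less_power order.strict_trans zero_less_one)
  have "vabs (\<Sum>i<p. \<eta> ^ i) \<le> r"
  proof -
    have "(\<Sum>i<p. \<eta> ^ i) = of_nat p + (\<Sum>i<p. \<eta> ^ i - 1)"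
      by (simp add: sum_subtractf)
    moreover have "vabs (\<Sum>i<p. \<eta> ^ i - 1) \<le> r"
      using r(1) \<eta>_r vabs_power_minus_1_le[of \<eta>] v1 by (intro vabs_sum_le) (auto intro: order_trans)
    ultimately show ?thesis using inverse_p_le_r vp by (auto intro: vabs_add_le)
  qed
  then have "vabs (\<eta> - 1) * vabs (\<Sum>i<p. \<eta> ^ i) \<le> vabs (\<zeta> ^ i - 1) * r"
    using \<eta>_le r(1) by (intro mult_mono) auto
  then have \<eta>p: "vabs (\<eta> ^ p - 1) \<le> r * vabs (\<zeta> ^ i - 1)"
    by (simp add: power_diff_1_eq vabs_mult mult.commute)
  have "\<zeta> ^ (p ^ N * l) = (\<eta> ^ p) ^ l" by (simp add: \<eta>_def NN flip: power_mult)
  then have "vabs (\<zeta> ^ (p ^ N * l) - 1) \<le> vabs (\<eta> ^ p - 1)"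
    using vabs_power_minus_1_le[of "\<eta> ^ p" l] v1 by (simp add: vabs_power)
  with \<eta>p show ?thesis by linarith
qed

lemma outer_root_pos:
  assumes "\<not> p ^ N dvd i"
  shows "vabs (\<zeta> ^ i - 1) > 0"
proof -
  have "\<not> p ^ (N + c) dvd i" using assms by (metis dvd_mult_left power_add)
  then show ?thesis using root_power by simp
qed

lemma inner_outer_roots_less:
  assumes "\<not> p ^ N dvd i"
  shows "vabs (\<zeta> ^ (p ^ N * l) - 1) < vabs (\<zeta> ^ i - 1)"
proof -
  have "r * vabs (\<zeta> ^ i - 1) < 1 * vabs (\<zeta> ^ i - 1)"
    using outer_root_pos[OF assms] r_less_1 by (intro mult_strict_right_mono) auto
  then show ?thesis using inner_outer_roots[OF assms, of l] by linarith
qed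

lemma vabs_inner_minus_outer:
  assumes "\<not> p ^ N dvd i"
  shows "vabs (\<zeta> ^ (p ^ N * l) - \<zeta> ^ i) = vabs (\<zeta> ^ i - 1)"
proof -
  have "vabs ((\<zeta> ^ (p ^ N * l) - 1) + (1 - \<zeta> ^ i)) = vabs (1 - \<zeta> ^ i)"
    using inner_outer_roots_less[OF assms, of l] by (intro vabs_add_eq) (simp add: vabs_minus_commute)
  then show ?thesis by (simp add: vabs_minus_commute)
qed

text \<open>Multiplying an outer root by an inner one moves it by less than its distance from 1.
  Hence that distance depends only on the exponent modulo \<open>p ^ N\<close>;
  \<open>outer_root_reflect\<close> adds invariance under negating the exponent.\<close>

lemma outer_root_periodic:
  assumes "\<not> p ^ N dvd i"
  shows "vabs (\<zeta> ^ (p ^ N * l + i) - 1) = vabs (\<zeta> ^ i - 1)"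
proof -
  have "\<zeta> ^ (p ^ N * l + i) - 1 = (\<zeta> ^ (p ^ N * l) - 1) + \<zeta> ^ (p ^ N * l) * (\<zeta> ^ i - 1)"
    by (simp add: power_add algebra_simps)
  also have "vabs \<dots> = vabs (\<zeta> ^ (p ^ N * l) * (\<zeta> ^ i - 1))"
    using inner_outer_roots_less[OF assms, of l] by (intro vabs_add_eq) (simp add: vabs_mult vabs_power)
  finally show ?thesis by (simp add: vabs_mult vabs_power)
qed

lemma outer_root_reflect:
  assumes "0 < d" "d < p ^ N"
  shows "vabs (\<zeta> ^ (p ^ N - d) - 1) = vabs (\<zeta> ^ d - 1)"
proof -
  have nd: "\<not> p ^ N dvd d" using assms by (simp add: nat_dvd_not_less)
  have "\<zeta> ^ d * (\<zeta> ^ (p ^ N - d) - 1) = \<zeta> ^ (p ^ N * 1) - \<zeta> ^ d"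
    using assms by (simp add: algebra_simps flip: power_add)
  then have "vabs (\<zeta> ^ d * (\<zeta> ^ (p ^ N - d) - 1)) = vabs (\<zeta> ^ d - 1)"
    using vabs_inner_minus_outer[OF nd, of 1] by simp
  then show ?thesis by (simp add: vabs_mult vabs_power)
qed

section \<open>The approximate indicator of the inner roots\<close>

definition \<theta> :: "'c \<Rightarrow> 'c" where
  "\<theta> x = (\<Prod>i\<in>{1..<p ^ N}. (x - \<zeta> ^ i) / (1 - \<zeta> ^ i))"

lemma not_dvd_index: "i \<in> {1..<p ^ N} \<Longrightarrow> \<not> p ^ N dvd i"
  by (auto simp: nat_dvd_not_less)

text \<open>Each factor equals \<open>1 + (\<zeta> ^ j - 1) / (1 - \<zeta> ^ i)\<close>, and the
  second term is an inner distance over an outer one.\<close>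

lemma \<theta>_inner:
  assumes "p ^ N dvd j"
  shows "vabs (\<theta> (\<zeta> ^ j) - 1) \<le> r"
  unfolding \<theta>_def
proof (rule vabs_prod_diff_1_le)
  fix i assume "i \<in> {1..<p ^ N}"
  then have nd: "\<not> p ^ N dvd i" by (rule not_dvd_index)
  have "1 - \<zeta> ^ i \<noteq> 0" using outer_root_pos[OF nd] by auto
  then have "(\<zeta> ^ j - \<zeta> ^ i) / (1 - \<zeta> ^ i) - 1 = (\<zeta> ^ j - 1) / (1 - \<zeta> ^ i)"
    by (simp add: field_simps)
  also have "vabs \<dots> = vabs (\<zeta> ^ j - 1) / vabs (\<zeta> ^ i - 1)"
    by (simp add: vabs_divide vabs_minus_commute)
  also have "\<dots> \<le> r"
    using inner_outer_roots[OF nd, of "j div p ^ N"] assms outer_root_pos[OF nd] by (simp add: field_simps)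
  finally show "vabs ((\<zeta> ^ j - \<zeta> ^ i) / (1 - \<zeta> ^ i) - 1) \<le> r" .
qed (use r r_less_1 in auto)

text \<open>In absolute value the numerators are distances to 1 of outer roots with exponents
  \<open>i\<^sub>0 - i\<close>. For \<open>i \<noteq> i\<^sub>0\<close> these residues only permute
  the indices of the denominators, so everything cancels except the factor at
  \<open>i\<^sub>0\<close>, which is again an inner distance over an outer one.\<close>

lemma \<theta>_outer:
  assumes "\<not> p ^ N dvd j"
  shows "vabs (\<theta> (\<zeta> ^ j)) \<le> r"
proof -
  define m k i\<^sub>0 where "m = p ^ N" and "k = j div m" and "i\<^sub>0 = j mod m"
  have j: "j = m * k + i\<^sub>0" by (simp add: k_def i\<^sub>0_def)
  have m0: "m > 0" using p_gt_1 by (simp add: m_def)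
  have i0: "i\<^sub>0 \<in> {1..<m}" using assms m0 by (auto simp: i\<^sub>0_def m_def mod_greater_zero_iff_not_dvd Suc_le_eq)
  \<comment> \<open>The representative of \<open>i\<^sub>0 - i\<close> modulo \<open>m\<close>; on
    the indices other than \<open>i\<^sub>0\<close> this is an involution, so it serves as its own
    inverse below.\<close>
  define \<sigma> where "\<sigma> i = (if i < i\<^sub>0 then i\<^sub>0 - i else m + i\<^sub>0 - i)" for i
  have dist: "vabs (\<zeta> ^ j - \<zeta> ^ i) = vabs (\<zeta> ^ \<sigma> i - 1)" if i: "i \<in> {1..<m} - {i\<^sub>0}" for i
  proof (cases "i < i\<^sub>0")
    case True
    have nd: "\<not> p ^ N dvd i\<^sub>0 - i" using i0 True by (auto simp: m_def nat_dvd_not_less)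
    have "\<zeta> ^ j - \<zeta> ^ i = \<zeta> ^ i * (\<zeta> ^ (m * k + (i\<^sub>0 - i)) - 1)"
      using True by (simp add: j algebra_simps flip: power_add)
    then show ?thesis using outer_root_periodic[OF nd, of k] True
      by (simp add: vabs_mult vabs_power \<sigma>_def m_def)
  next
    case False
    then have d: "0 < i - i\<^sub>0" "i - i\<^sub>0 < p ^ N" using i by (auto simp: m_def)
    have nd: "\<not> p ^ N dvd i - i\<^sub>0" using d by (simp add: nat_dvd_not_less)
    have "\<zeta> ^ j - \<zeta> ^ i = \<zeta> ^ i\<^sub>0 * (\<zeta> ^ (p ^ N * k) - \<zeta> ^ (i - i\<^sub>0))"
      using False by (simp add: j m_def algebra_simps flip: power_add)
    then have "vabs (\<zeta> ^ j - \<zeta> ^ i) = vabs (\<zeta> ^ (i - i\<^sub>0) - 1)"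
      using vabs_inner_minus_outer[OF nd] by (simp add: vabs_mult vabs_power)
    also have "\<dots> = vabs (\<zeta> ^ (p ^ N - (i - i\<^sub>0)) - 1)" using outer_root_reflect[OF d] by simp
    also have "p ^ N - (i - i\<^sub>0) = \<sigma> i" using False d by (simp add: \<sigma>_def m_def)
    finally show ?thesis .
  qed
  have bij: "(\<Prod>i\<in>{1..<m} - {i\<^sub>0}. vabs (\<zeta> ^ \<sigma> i - 1)) = (\<Prod>i\<in>{1..<m} - {i\<^sub>0}. vabs (\<zeta> ^ i - 1))"
    by (rule prod.reindex_bij_witness[where i = \<sigma> and j = \<sigma>]) (use i0 in \<open>auto simp: \<sigma>_def\<close>)
  have nz: "(\<Prod>i\<in>{1..<m} - {i\<^sub>0}. vabs (\<zeta> ^ i - 1)) \<noteq> 0"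
    using outer_root_pos not_dvd_index by (auto simp: m_def)
  have "vabs (\<theta> (\<zeta> ^ j)) = (\<Prod>i\<in>{1..<m}. vabs (\<zeta> ^ j - \<zeta> ^ i) / vabs (\<zeta> ^ i - 1))"
    unfolding \<theta>_def m_def by (simp add: vabs_prod vabs_divide vabs_minus_commute)
  also have "\<dots> = vabs (\<zeta> ^ j - \<zeta> ^ i\<^sub>0) / vabs (\<zeta> ^ i\<^sub>0 - 1) *
      (\<Prod>i\<in>{1..<m} - {i\<^sub>0}. vabs (\<zeta> ^ j - \<zeta> ^ i) / vabs (\<zeta> ^ i - 1))"
    by (rule prod.remove) (use i0 in auto)
  also have "(\<Prod>i\<in>{1..<m} - {i\<^sub>0}. vabs (\<zeta> ^ j - \<zeta> ^ i) / vabs (\<zeta> ^ i - 1)) = 1"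
    using bij nz by (simp add: prod_dividef dist)
  also have "\<zeta> ^ j - \<zeta> ^ i\<^sub>0 = \<zeta> ^ i\<^sub>0 * (\<zeta> ^ (p ^ N * k) - 1)"
    by (simp add: j m_def algebra_simps power_add)
  finally have "vabs (\<theta> (\<zeta> ^ j)) = vabs (\<zeta> ^ (p ^ N * k) - 1) / vabs (\<zeta> ^ i\<^sub>0 - 1)"
    by (simp add: vabs_mult vabs_power)
  also have "\<dots> \<le> r"
    using i0 inner_outer_roots[of i\<^sub>0 k] outer_root_pos[of i\<^sub>0] not_dvd_index[of i\<^sub>0]
    by (simp add: field_simps m_def)
  finally show ?thesis .
qed

text \<open>
  Grouping the factors of \<open>\<Prod>(1 - \<zeta>\<^sup>i) = p\<^bsup>N+c\<^esup>\<close> over \<open>0 < i < p\<^bsup>N+c\<^esup>\<close> by the residue of \<open>i\<close> modulo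
  \<open>p\<^sup>N\<close> shows that the denominator of \<^term>\<open>\<theta>\<close> only has absolute value \<open>p\<^bsup>-N/p^c\<^esup>\<close>, as opposed to
  the \<open>p\<^bsup>-N\<^esup>\<close> of the exact indicator function.
\<close>

lemma denominator_power:
  "(\<Prod>i\<in>{1..<p ^ N}. vabs (1 - \<zeta> ^ i)) ^ (p ^ c) = (1 / p) ^ N"
proof -
  define m where "m = p ^ N"
  have m0: "m > 0" using p_gt_1 by (simp add: m_def)
  have full: "(\<Prod>i\<in>{1..<p ^ (N + c)}. vabs (1 - \<zeta> ^ i)) = (1 / p) ^ (N + c)"
  proof -
    have "(\<Prod>i\<in>{1..<p ^ (N + c)}. 1 - \<zeta> ^ i) = of_nat (p ^ (N + c))"
      by (rule prod_one_minus_roots_of_unity)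
        (use root_power primitive_root_of_unity_inj_on[OF prim] p_gt_1 in auto)
    then have "vabs (\<Prod>i\<in>{1..<p ^ (N + c)}. 1 - \<zeta> ^ i) = vabs (of_nat (p ^ (N + c)) :: 'c)" by simp
    then show ?thesis by (simp add: vabs_prod vabs_power vp)
  qed
  \<comment> \<open>The multiples of \<open>m\<close> contribute the same kind of product, for the
    root \<open>\<zeta> ^ m\<close> of order \<open>p ^ c\<close>, so its value is known as well and
    can be divided out.\<close>
  have prim': "primitive_root_of_unity (p ^ c) (\<zeta> ^ m)"
    using p_gt_1 unfolding primitive_root_of_unity_def m_def
    by (auto simp: root_power power_add simp flip: power_mult)
  have inner: "(\<Prod>l\<in>{1..<p ^ c}. vabs (1 - \<zeta> ^ (m * l))) = (1 / p) ^ c"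
  proof -
    have "(\<Prod>l\<in>{1..<p ^ c}. 1 - (\<zeta> ^ m) ^ l) = of_nat (p ^ c)"
      by (rule prod_one_minus_roots_of_unity)
        (use primitive_root_of_unity_inj_on[OF prim'] prim' p_gt_1 in \<open>auto simp: primitive_root_of_unity_def\<close>)
    then have "vabs (\<Prod>l\<in>{1..<p ^ c}. 1 - (\<zeta> ^ m) ^ l) = vabs (of_nat (p ^ c) :: 'c)" by simp
    then show ?thesis by (simp add: vabs_prod vabs_power vp power_mult)
  qed
  have multiples: "(\<Prod>i\<in>{i\<in>{1..<p ^ (N + c)}. m dvd i}. vabs (1 - \<zeta> ^ i)) = (\<Prod>l\<in>{1..<p ^ c}. vabs (1 - \<zeta> ^ (m * l)))"
    by (rule prod.reindex_bij_witness[where i = "\<lambda>l. m * l" and j = "\<lambda>i. i div m"])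
      (use m0 in \<open>auto simp: m_def power_add less_mult_imp_div_less mult.commute Suc_le_eq div_greater_zero_iff dvd_imp_le\<close>)
  have nonmultiples: "(\<Prod>i\<in>{i\<in>{1..<p ^ (N + c)}. \<not> m dvd i}. vabs (1 - \<zeta> ^ i)) =
      (\<Prod>(l, i)\<in>{..<p ^ c} \<times> {1..<m}. vabs (1 - \<zeta> ^ i))"
  proof (rule prod.reindex_bij_witness[where i = "\<lambda>(l, i). m * l + i" and j = "\<lambda>i. (i div m, i mod m)"])
    fix i assume i: "i \<in> {i\<in>{1..<p ^ (N + c)}. \<not> m dvd i}"
    then show "(case (i div m, i mod m) of (l, i) \<Rightarrow> m * l + i) = i"
      "(i div m, i mod m) \<in> {..<p ^ c} \<times> {1..<m}"
      using m0 by (auto simp: m_def power_add less_mult_imp_div_less mult.commute Suc_le_eq mod_greater_zero_iff_not_dvd)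
    have "\<not> p ^ N dvd i mod m" using i by (simp add: m_def dvd_mod_iff)
    from outer_root_periodic[OF this, of "i div m"]
    show "(case (i div m, i mod m) of (l, i) \<Rightarrow> vabs (1 - \<zeta> ^ i)) = vabs (1 - \<zeta> ^ i)"
      by (simp add: m_def vabs_minus_commute[of 1])
  next
    fix b assume b: "b \<in> {..<p ^ c} \<times> {1..<m}"
    obtain l i where li: "b = (l, i)" by force
    have "l < p ^ c" "0 < i" "i < m" using b li by auto
    then have "m * l + i < p ^ (N + c)"
    proof -
      have "m * l + i < m * (l + 1)" using \<open>i < m\<close> by simp
      also have "\<dots> \<le> m * p ^ c" using \<open>l < p ^ c\<close> by (intro mult_left_mono) auto
      finally show ?thesis by (simp add: m_def power_add)
    qed
    then show "(case b of (l, i) \<Rightarrow> m * l + i) \<in> {i\<in>{1..<p ^ (N + c)}. \<not> m dvd i}"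
      using li \<open>0 < i\<close> \<open>i < m\<close> dvd_add_right_iff[of m "m * l" i] nat_dvd_not_less[of i m] by auto
    show "((case b of (l, i) \<Rightarrow> m * l + i) div m, (case b of (l, i) \<Rightarrow> m * l + i) mod m) = b"
      using li \<open>i < m\<close> by auto
  qed
  have power: "(\<Prod>(l, i)\<in>{..<p ^ c} \<times> {1..<m}. vabs (1 - \<zeta> ^ i)) = (\<Prod>i\<in>{1..<m}. vabs (1 - \<zeta> ^ i)) ^ (p ^ c)"
    by (subst prod.cartesian_product[symmetric]) simp
  have "(\<Prod>i\<in>{1..<p ^ (N + c)}. vabs (1 - \<zeta> ^ i)) =
     (\<Prod>i\<in>{i\<in>{1..<p ^ (N + c)}. m dvd i}. vabs (1 - \<zeta> ^ i)) *
     (\<Prod>i\<in>{i\<in>{1..<p ^ (N + c)}. \<not> m dvd i}. vabs (1 - \<zeta> ^ i))"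
    by (subst prod.union_disjoint[symmetric]) (auto intro!: prod.cong)
  then have "(1 / p) ^ (N + c) = (1 / p) ^ c * (\<Prod>i\<in>{1..<m}. vabs (1 - \<zeta> ^ i)) ^ (p ^ c)"
    unfolding full multiples nonmultiples inner power .
  then show ?thesis using p_gt_1 unfolding m_def by (simp only: power_add) simp
qed

end

section \<open>Locally constant functions of compact support\<close>

lemma dist_vabs_swap: "dist x y = vabs (y - x :: 'a::nonarch_valued_field)"
  by (metis dist_commute dist_vabs)

lemma dist_add_left: "dist (a + x) (a + y) = dist x (y :: 'a::nonarch_valued_field)"
  by (simp add: dist_vabs)

lemma dist_ultrametric: "dist x z \<le> max (dist x y) (dist y (z::'a::nonarch_valued_field))"
  using vabs_ultrametric[of "x - y" "y - z"] by (simp add: dist_vabs)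

text \<open>By the ultrametric inequality every point of a ball is a centre of it. So closed balls
  are open, and balls of equal radius coincide or are disjoint.\<close>

lemma cball_eq_of_mem:
  assumes "b \<in> cball (a::'a::nonarch_valued_field) d"
  shows "cball b d = cball a d"
proof -
  have "dist b x \<le> d \<longleftrightarrow> dist a x \<le> d" for x
    using assms dist_ultrametric[of b x a] dist_ultrametric[of a x b] by (auto simp: dist_commute)
  then show ?thesis by auto
qed

lemma open_cball_nonarch:
  assumes "d > 0"
  shows "open (cball (a::'a::nonarch_valued_field) d)"
  unfolding open_contains_cball using assms cball_eq_of_mem by blast

lemma translate_cball: "(+) a ` cball b d = cball (a + b :: 'a::nonarch_valued_field) d"
proof -
  have "x \<in> (+) a ` cball b d \<longleftrightarrow> x \<in> cball (a + b) d" for x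
  proof
    assume "x \<in> cball (a + b) d"
    then have "x - a \<in> cball b d" by (simp add: dist_vabs_swap algebra_simps)
    then have "a + (x - a) \<in> (+) a ` cball b d" by (rule imageI)
    then show "x \<in> (+) a ` cball b d" by simp
  qed (auto simp: dist_add_left)
  then show ?thesis by blast
qed

lemma ring_of_integers_eq_cball: "ring_of_integers = cball (0::'a::nonarch_valued_field) 1"
  by (auto simp: ring_of_integers_def dist_vabs_swap)

text \<open>Affine maps are Lipschitz; this carries compactness between balls of different centres
  and radii.\<close>

lemma compact_affine_image:
  assumes "compact (X :: 'a::nonarch_valued_field set)"
  shows "compact ((\<lambda>y. a + u * y) ` X)"
proof (rule compact_continuous_image[OF _ assms])
  have "dist (a + u * x) (a + u * y) = vabs u * dist x y" for x y
    by (simp add: dist_vabs flip: vabs_mult right_diff_distrib)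
  then have "(vabs u)-lipschitz_on X (\<lambda>y. a + u * y)"
    by (auto simp: lipschitz_on_def)
  then show "continuous_on X (\<lambda>y. a + u * y)" by (rule lipschitz_on_continuous_on)
qed

text \<open>Take a finite subcover by balls of radius \<open>d\<close> and keep one centre for each
  distinct ball.\<close>

lemma finite_cball_partition:
  fixes X :: "'a::nonarch_valued_field set"
  assumes "compact X" "d > 0" "\<And>x. x \<in> X \<Longrightarrow> cball x d \<subseteq> X"
  obtains R where "finite R" "R \<subseteq> X" "X = (\<Union>a\<in>R. cball a d)" "disjoint_family_on (\<lambda>a. cball a d) R"
proof -
  have "X \<subseteq> (\<Union>a\<in>X. cball a d)" using assms(2) by (auto intro!: bexI)
  then obtain C where C: "C \<subseteq> X" "finite C" "X \<subseteq> (\<Union>a\<in>C. cball a d)"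
    using compactE_image[OF assms(1), of X "\<lambda>a. cball a d"] open_cball_nonarch[OF assms(2)] by metis
  obtain R where R: "R \<subseteq> C" "inj_on (\<lambda>a. cball a d) R" "(\<lambda>a. cball a d) ` C = (\<lambda>a. cball a d) ` R"
    using subset_image_inj[of "(\<lambda>a. cball a d) ` C" "\<lambda>a. cball a d" C] by auto
  have "disjoint_family_on (\<lambda>a. cball a d) R"
    unfolding disjoint_family_on_def
  proof (intro ballI impI, rule ccontr)
    fix a b assume ab: "a \<in> R" "b \<in> R" "a \<noteq> b" "cball a d \<inter> cball b d \<noteq> {}"
    then obtain z where "z \<in> cball a d" "z \<in> cball b d" by blast
    then have "cball a d = cball b d" using cball_eq_of_mem by metis
    then show False using ab R(2) by (auto dest: inj_onD)
  qed
  moreover have "X = (\<Union>a\<in>R. cball a d)"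
    using C R(1,3) assms(3) by (metis (no_types, lifting) UN_least dual_order.eq_iff in_mono)
  ultimately show ?thesis using that C R finite_subset by (metis subset_trans)
qed

text \<open>\<open>level d f\<close>: \<open>f\<close> comes from a function on the finite group \<open>{|x| \<le> 1/d} / {|x| \<le> d}\<close>.\<close>

definition level :: "real \<Rightarrow> ('a::nonarch_valued_field \<Rightarrow> 'b::zero) \<Rightarrow> bool" where
  "level d f \<longleftrightarrow> 0 < d \<and> d \<le> 1 \<and> (\<forall>x y. dist x y \<le> d \<longrightarrow> f x = f y) \<and> (\<forall>x. f x \<noteq> 0 \<longrightarrow> vabs x \<le> 1 / d)"

lemma level_mono:
  assumes "level d f" "0 < e" "e \<le> d"
  shows "level e f"
proof -
  have "1 / d \<le> 1 / e" using assms by (intro divide_left_mono) (auto simp: level_def)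
  then show ?thesis using assms unfolding level_def by force
qed

text \<open>The setting of the analysis. The values of \<open>vabs\<close> at \<open>p\<close> come
  from the embeddings of the p-adic field, and compactness of the ring of integers is obtained in
  \<open>theorem1\<close> from a nonzero Schwartz function.\<close>

locale padic_fourier =
  fixes p :: nat
    and \<psi> :: "'f::nonarch_valued_field \<Rightarrow> 'c::{nonarch_valued_field, alg_closed_field}"
    and \<mu> :: "'f set \<Rightarrow> 'c"
  assumes p: "prime p"
    and vabs_p_domain: "vabs (of_nat p :: 'f) = 1 / p"
    and vabs_p: "vabs (of_nat p :: 'c) = 1 / p"
    and compact_integers: "compact (ring_of_integers :: 'f set)"
    and char: "additive_character \<psi>"
    and annihilator_integers: "annihilator \<psi> ring_of_integers = ring_of_integers"
    and haar: "normalized_haar_distribution \<mu>"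
begin

lemma p_gt_1: "p > 1"
  using p by (rule prime_gt_1_nat)

lemma p_nonzero_domain [simp]: "of_nat p \<noteq> (0 :: 'f)"
proof
  assume "of_nat p = (0 :: 'f)"
  then have "1 / real p = 0" using vabs_p_domain by simp
  then show False using p_gt_1 by simp
qed

lemma p_nonzero [simp]: "of_nat p \<noteq> (0 :: 'c)"
proof
  assume "of_nat p = (0 :: 'c)"
  then have "1 / real p = 0" using vabs_p by simp
  then show False using p_gt_1 by simp
qed

text \<open>Every ball is a closed subset of a translate of \<open>p^(-k)\<close> times the ring of
  integers for large \<open>k\<close>.\<close>

lemma compact_cball: "compact (cball (a::'f) d)"
proof -
  obtain k where k: "d < real p ^ k" using real_arch_pow[of "real p" d] p_gt_1 by auto
  define u where "u = (1 / of_nat p ^ k :: 'f)"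
  have u: "vabs u = real p ^ k"
    by (simp add: u_def vabs_divide vabs_power vabs_p_domain power_divide)
  have u0: "u \<noteq> 0" by (simp add: u_def)
  have "cball a (real p ^ k) \<subseteq> (\<lambda>y. a + u * y) ` ring_of_integers"
  proof
    fix x assume "x \<in> cball a (real p ^ k)"
    then have "vabs ((x - a) / u) \<le> 1"
      using p_gt_1 by (simp add: dist_vabs_swap vabs_divide u)
    then have "a + u * ((x - a) / u) \<in> (\<lambda>y. a + u * y) ` ring_of_integers"
      by (intro imageI) (simp add: ring_of_integers_def)
    then show "x \<in> (\<lambda>y. a + u * y) ` ring_of_integers" using u0 by simp
  qed
  then have "cball a d = (\<lambda>y. a + u * y) ` ring_of_integers \<inter> cball a d"
    using k by fastforce
  moreover have "compact \<dots>"
    by (intro compact_Int_closed compact_affine_image compact_integers closed_cball)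
  ultimately show ?thesis by simp
qed

section \<open>Volumes and integrals against the distribution\<close>

lemma haar_disjoint_Un:
  assumes "compact A" "open A" "compact B" "open B" "A \<inter> B = {}"
  shows "\<mu> (A \<union> B) = \<mu> A + \<mu> B"
  using haar assms unfolding normalized_haar_distribution_def by blast

lemma haar_translate:
  assumes "compact A" "open A"
  shows "\<mu> ((+) a ` A) = \<mu> A"
  using haar assms unfolding normalized_haar_distribution_def by blast

lemma haar_integers [simp]: "\<mu> (cball 0 1) = 1"
  using haar unfolding normalized_haar_distribution_def ring_of_integers_eq_cball by blast

lemma haar_empty [simp]: "\<mu> {} = 0"
proof -
  have "\<mu> ({} \<union> {}) = \<mu> {} + \<mu> {}" by (rule haar_disjoint_Un) auto
  then have "\<mu> {} = \<mu> {} + \<mu> {}" by simp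
  then show ?thesis by (simp only: add_cancel_right_right)
qed

lemma haar_UN:
  assumes "finite R" "\<And>a. a \<in> R \<Longrightarrow> compact (A a) \<and> open (A a)" "disjoint_family_on A R"
  shows "\<mu> (\<Union>a\<in>R. A a) = (\<Sum>a\<in>R. \<mu> (A a))"
  using assms
proof (induction R rule: finite_induct)
  case (insert b R)
  have "\<mu> (A b \<union> (\<Union>a\<in>R. A a)) = \<mu> (A b) + \<mu> (\<Union>a\<in>R. A a)"
  proof (rule haar_disjoint_Un)
    show "A b \<inter> (\<Union>a\<in>R. A a) = {}"
      using insert.hyps(2) insert.prems(2) by (auto simp: disjoint_family_on_def)
    show "compact (\<Union>a\<in>R. A a)" using insert by (intro compact_UN) auto
  qed (use insert.prems in auto)
  moreover have "disjoint_family_on A R"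
    using insert.prems(2) by (auto simp: disjoint_family_on_def)
  ultimately show ?case using insert by simp
qed simp

lemma haar_cball: "d > 0 \<Longrightarrow> \<mu> (cball a d) = \<mu> (cball 0 d)"
  using haar_translate[OF compact_cball open_cball_nonarch, of d a 0] by (simp add: translate_cball)

lemma haar_UN_cball:
  assumes "finite R" "d > 0" "disjoint_family_on (\<lambda>a. cball a d) R"
  shows "\<mu> (\<Union>a\<in>R. cball a d) = of_nat (card R) * \<mu> (cball 0 d)"
proof -
  have "\<mu> (\<Union>a\<in>R. cball a d) = (\<Sum>a\<in>R. \<mu> (cball a d))"
    using assms by (intro haar_UN) (auto intro: compact_cball open_cball_nonarch)
  also have "\<dots> = (\<Sum>a\<in>R. \<mu> (cball 0 d))" by (intro sum.cong refl haar_cball assms)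
  finally show ?thesis by simp
qed

lemma ex_representatives:
  assumes "0 < d" "d \<le> 1"
  obtains R where "finite R" "cball 0 (1 / d) = (\<Union>a\<in>R. cball (a::'f) d)"
    "disjoint_family_on (\<lambda>a. cball a d) R"
proof (rule finite_cball_partition[OF compact_cball assms(1)])
  fix x :: 'f assume x: "x \<in> cball 0 (1 / d)"
  have "d * d \<le> 1 * 1" using assms by (intro mult_mono) auto
  then have "d \<le> 1 / d" using assms by (simp add: field_simps)
  then show "cball x d \<subseteq> cball 0 (1 / d)"
    using cball_eq_of_mem[OF x] by (metis subset_cball)
qed (rule that)

lemma level_fibre:
  assumes f: "level d f" and R: "cball 0 (1 / d) = (\<Union>a\<in>R. cball (a::'f) d)" and c: "c \<noteq> 0"
  shows "f -` {c} = (\<Union>a\<in>{a\<in>R. f a = c}. cball a d)"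
proof (intro equalityI subsetI)
  fix x assume x: "x \<in> f -` {c}"
  then have "x \<in> cball 0 (1 / d)" using f c by (auto simp: level_def dist_vabs_swap)
  then obtain a where a: "a \<in> R" "x \<in> cball a d" using R by auto
  then have "f a = c" using f x unfolding level_def by (metis mem_cball vimage_singleton_eq)
  with a show "x \<in> (\<Union>a\<in>{a\<in>R. f a = c}. cball a d)" by auto
next
  fix x assume "x \<in> (\<Union>a\<in>{a\<in>R. f a = c}. cball a d)"
  then obtain a where "f a = c" "x \<in> cball a d" by auto
  then show "x \<in> f -` {c}" using f unfolding level_def by (metis mem_cball vimage_singleton_eq)
qed

lemma level_range:
  assumes f: "level d f" and R: "cball 0 (1 / d) = (\<Union>a\<in>R. cball (a::'f) d)"
  shows "range f - {0} = f ` R - {0}"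
proof -
  have "c \<in> f ` R" if "c \<in> range f" "c \<noteq> 0" for c
  proof -
    obtain x where "x \<in> f -` {c}" using \<open>c \<in> range f\<close> by auto
    then show ?thesis unfolding level_fibre[OF f R \<open>c \<noteq> 0\<close>] by auto
  qed
  then show ?thesis by auto
qed

text \<open>All balls of radius \<open>d\<close> have the same volume, so the sum over values
  regroups into a sum over representatives. In this form two functions of a common level can be
  added, whereas the sets of values in the definition do not combine.\<close>

lemma distr_integral_level:
  assumes f: "level d f" and fin: "finite R" and R: "cball 0 (1 / d) = (\<Union>a\<in>R. cball (a::'f) d)"
    and disj: "disjoint_family_on (\<lambda>a. cball a d) R"
  shows "distr_integral \<mu> f = \<mu> (cball 0 d) * (\<Sum>a\<in>R. f a)"
proof -
  have d: "d > 0" using f by (simp add: level_def)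
  have "c * \<mu> (f -` {c}) = (\<Sum>a\<in>{a\<in>R. f a = c}. f a * \<mu> (cball 0 d))" if "c \<in> f ` R - {0}" for c
  proof -
    have "\<mu> (f -` {c}) = of_nat (card {a\<in>R. f a = c}) * \<mu> (cball 0 d)"
      unfolding level_fibre[OF f R, of c, simplified] using that fin disj d
      by (subst level_fibre[OF f R]) (auto intro!: haar_UN_cball simp: disjoint_family_on_def)
    then show ?thesis by simp
  qed
  then have "distr_integral \<mu> f = (\<Sum>c\<in>f ` R - {0}. \<Sum>a\<in>{a\<in>R. f a = c}. f a * \<mu> (cball 0 d))"
    unfolding distr_integral_def level_range[OF f R] by (intro sum.cong) auto
  also have "\<dots> = (\<Sum>c\<in>f ` R. \<Sum>a\<in>{a\<in>R. f a = c}. f a * \<mu> (cball 0 d))"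
    using fin by (intro sum.mono_neutral_left) auto
  also have "\<dots> = (\<Sum>a\<in>R. f a * \<mu> (cball 0 d))"
    using sum.image_gen[OF fin, of "\<lambda>a. f a * \<mu> (cball 0 d)" f] by simp
  finally show ?thesis by (simp add: mult.commute sum_distrib_right sum_distrib_left)
qed

section \<open>Schwartz functions and their closure properties\<close>

definition schwartz :: "('f \<Rightarrow> 'c) \<Rightarrow> bool" where
  "schwartz f \<longleftrightarrow> (\<exists>d. level d f)"

lemma level_imp_schwartz_space:
  assumes "level d (f :: 'f \<Rightarrow> 'c)"
  shows "f \<in> schwartz_space"
proof -
  have d: "d > 0" using assms by (simp add: level_def)
  have "loc_const f"
    unfolding loc_const_def
  proof
    fix x
    have "f constant_on cball x d"
      using assms unfolding level_def constant_on_def by (metis mem_cball)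
    then show "\<exists>U. open U \<and> x \<in> U \<and> f constant_on U"
      using d open_cball_nonarch[OF d, of x] by (intro exI[of _ "cball x d"]) auto
  qed
  moreover have "closure {x. f x \<noteq> 0} \<subseteq> cball 0 (1 / d)"
    using assms by (intro closure_minimal) (auto simp: level_def dist_vabs)
  then have "closure {x. f x \<noteq> 0} = cball 0 (1 / d) \<inter> closure {x. f x \<noteq> 0}" by auto
  then have "compact (closure {x. f x \<noteq> 0})"
    by (metis compact_Int_closed compact_cball closed_closure)
  ultimately show ?thesis by (simp add: schwartz_space_def)
qed

text \<open>Compactness makes local constancy uniform: finitely many balls on which \<open>f\<close>
  is constant cover the closed support, and by the ultrametric inequality the smallest radius works
  everywhere.\<close>

lemma schwartz_space_imp_schwartz:
  assumes "f \<in> schwartz_space"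
  shows "schwartz f"
proof -
  define K where "K = closure {x. f x \<noteq> 0}"
  have lc: "loc_const f" and K: "compact K" using assms by (auto simp: schwartz_space_def K_def)
  have "\<exists>e>0. \<forall>y\<in>cball x e. f y = f x" for x :: 'f
  proof -
    obtain U where U: "open U" "x \<in> U" "f constant_on U" using lc unfolding loc_const_def by blast
    then obtain e where "e > 0" "cball x e \<subseteq> U" using open_contains_cball by blast
    then show ?thesis using U unfolding constant_on_def by (metis subsetD)
  qed
  then obtain e :: "'f \<Rightarrow> real" where e: "\<And>x. e x > 0" "\<And>x y. y \<in> cball x (e x) \<Longrightarrow> f y = f x" by metis
  obtain C where C: "C \<subseteq> K" "finite C" "K \<subseteq> (\<Union>x\<in>C. cball x (e x))"
    using compactE_image[OF K, of K "\<lambda>x. cball x (e x)"] e(1) open_cball_nonarch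
    by (metis (no_types, lifting) UN_I centre_in_cball less_imp_le subsetI)
  obtain b where b: "\<And>x. x \<in> K \<Longrightarrow> dist 0 x \<le> b"
    using compact_imp_bounded[OF K] bounded_any_center[of K 0] by blast
  define \<beta> where "\<beta> = max 1 b"
  have \<beta>: "\<beta> > 0" "b \<le> \<beta>" by (simp_all add: \<beta>_def)
  \<comment> \<open>The entry \<open>1 / \<beta>\<close> makes \<open>1 / d\<close> bound the
    support; the maximum with 1 in \<open>\<beta>\<close> keeps it positive.\<close>
  define d where "d = Min (insert 1 (insert (1 / \<beta>) (e ` C)))"
  have d0: "d > 0" using C(2) e(1) \<beta> by (simp add: d_def)
  have d: "d \<le> 1" "d \<le> 1 / \<beta>" "\<And>x. x \<in> C \<Longrightarrow> d \<le> e x"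
    unfolding d_def using C(2) by (auto intro!: Min_le simp del: Min_insert)
  have *: "f y = f x" if "dist x y \<le> d" "x \<in> K" for x y :: 'f
  proof -
    obtain z where z: "z \<in> C" "x \<in> cball z (e z)" using C(3) \<open>x \<in> K\<close> by auto
    have "y \<in> cball x (e z)" using that(1) d(3)[OF z(1)] by simp
    then have "y \<in> cball z (e z)" using cball_eq_of_mem[OF z(2)] by simp
    then show ?thesis using e(2) z(2) by metis
  qed
  have "{x. f x \<noteq> 0} \<subseteq> K" unfolding K_def by (rule closure_subset)
  then have out: "f x = 0" if "x \<notin> K" for x :: 'f using that by auto
  have "level d f"
    unfolding level_def
  proof (intro conjI allI impI)
    fix x y :: 'f assume "dist x y \<le> d"
    then show "f x = f y" using *[of x y] *[of y x] out by (metis dist_commute)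
  next
    fix x assume "f x \<noteq> 0"
    then have "x \<in> K" using out by blast
    then have "vabs x \<le> \<beta>" using b[of x] \<beta> by (simp add: dist_vabs)
    also have "\<beta> \<le> 1 / d" using d d0 \<beta> by (simp add: field_simps)
    finally show "vabs x \<le> 1 / d" .
  qed (use d d0 in auto)
  then show ?thesis unfolding schwartz_def by blast
qed

lemma schwartz_space_iff: "f \<in> schwartz_space \<longleftrightarrow> schwartz f"
  using level_imp_schwartz_space schwartz_space_imp_schwartz unfolding schwartz_def by blast

lemma schwartz_common_level:
  assumes "schwartz f" "schwartz g"
  obtains d where "level d f" "level d g"
proof -
  obtain a b where ab: "level a f" "level b g" using assms unfolding schwartz_def by blast
  then have "0 < min a b" by (simp add: level_def)
  then show ?thesis using that[of "min a b"] ab level_mono by (metis min.cobounded1 min.cobounded2)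
qed

lemma schwartz_add:
  assumes "schwartz f" "schwartz g"
  shows "schwartz (\<lambda>x. f x + g x)"
proof -
  obtain d where "level d f" "level d g" using schwartz_common_level[OF assms] .
  then have "level d (\<lambda>x. f x + g x)"
    unfolding level_def by (metis add.right_neutral)
  then show ?thesis unfolding schwartz_def by blast
qed

lemma schwartz_mult_const: "schwartz f \<Longrightarrow> schwartz (\<lambda>x. c * f x)"
proof -
  assume "schwartz f"
  then obtain d where "level d f" unfolding schwartz_def by blast
  then have "level d (\<lambda>x. c * f x)" unfolding level_def by (metis mult_zero_right)
  then show ?thesis unfolding schwartz_def by blast
qed

lemma schwartz_zero: "schwartz (\<lambda>x. 0)"
  unfolding schwartz_def level_def by (rule exI[of _ 1]) auto

lemma schwartz_sum: "(\<And>i. i \<in> A \<Longrightarrow> schwartz (f i)) \<Longrightarrow> schwartz (\<lambda>x. \<Sum>i\<in>A. f i x)"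
proof (induction A rule: infinite_finite_induct)
  case (insert a A)
  have "schwartz (\<lambda>x. f a x + (\<Sum>i\<in>A. f i x))"
  proof (rule schwartz_add)
    show "schwartz (f a)" by (rule insert.prems) simp
    show "schwartz (\<lambda>x. \<Sum>i\<in>A. f i x)" by (rule insert.IH, rule insert.prems) simp
  qed
  then show ?case using insert.hyps by simp
next
  case (infinite A)
  then show ?case using schwartz_zero by simp
next
  case empty
  show ?case using schwartz_zero by simp
qed

lemma schwartz_diff:
  assumes "schwartz f" "schwartz g"
  shows "schwartz (\<lambda>x. f x - g x)"
  using schwartz_add[OF assms(1) schwartz_mult_const[OF assms(2), of "-1"]] by simp

lemma schwartz_indicator:
  assumes "e > 0"
  shows "schwartz (indicator (cball 0 e))"
proof -
  \<comment> \<open>The bound \<open>e\<close> gives invariance under shifts of size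
    \<open>d\<close>, the bound \<open>1 / e\<close> puts the support inside radius
    \<open>1 / d\<close>.\<close>
  define d where "d = min 1 (min e (1 / e))"
  have d: "d > 0" "d \<le> 1" "d \<le> e" "d \<le> 1 / e" using assms by (auto simp: d_def)
  have "x \<in> cball 0 e \<longleftrightarrow> y \<in> cball 0 e" if "dist x y \<le> d" for x y :: 'f
    using that d(3) dist_ultrametric[of 0 x y] dist_ultrametric[of 0 y x] by (auto simp: dist_commute)
  moreover have "e \<le> 1 / d" using d assms by (simp add: field_simps)
  ultimately have "level d (indicator (cball 0 e) :: 'f \<Rightarrow> 'c)"
    using assms d unfolding level_def by (auto simp: indicator_def dist_vabs_swap)
  then show ?thesis unfolding schwartz_def by blast
qed

lemma schwartz_translate:
  assumes "schwartz f"
  shows "schwartz (\<lambda>x. f (x - a))"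
proof -
  obtain d where d: "level d f" using assms unfolding schwartz_def by blast
  \<comment> \<open>The second bound gives \<open>vabs a \<le> 1 / e\<close>, so the shifted support
    still lies in the ball of radius \<open>1 / e\<close>.\<close>
  define e where "e = min d (1 / (1 + vabs a))"
  have e: "0 < e" "e \<le> d" "e \<le> 1 / (1 + vabs a)"
    using d by (auto simp: e_def level_def add_pos_nonneg)
  note d' = level_mono[OF d e(1,2)]
  have "level e (\<lambda>x. f (x - a))"
    unfolding level_def
  proof (intro conjI allI impI)
    fix x y :: 'f assume "dist x y \<le> e"
    then have "dist (x - a) (y - a) \<le> e" by (simp add: dist_vabs)
    then show "f (x - a) = f (y - a)" using d' unfolding level_def by blast
  next
    fix x assume "f (x - a) \<noteq> 0"
    then have "vabs (x - a) \<le> 1 / e" using d' unfolding level_def by blast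
    moreover have "vabs a \<le> 1 / e"
    proof -
      have "1 + vabs a \<le> 1 / e" using e by (simp add: field_simps add_pos_nonneg)
      then show ?thesis by simp
    qed
    ultimately show "vabs x \<le> 1 / e" using vabs_add_le[of "x - a" "1 / e" a] by simp
  qed (use d' in \<open>auto simp: level_def\<close>)
  then show ?thesis unfolding schwartz_def by blast
qed

section \<open>The additive character\<close>

lemma char_add: "\<psi> (x + y) = \<psi> x * \<psi> y"
  using char unfolding additive_character_def by blast

lemma char_nonzero [simp]: "\<psi> x \<noteq> 0"
  using char unfolding additive_character_def by blast

lemma char_zero [simp]: "\<psi> 0 = 1"
proof -
  have "\<psi> 0 * \<psi> 0 = \<psi> 0 * 1" using char_add[of 0 0] by simp
  then show ?thesis unfolding mult_left_cancel[OF char_nonzero] .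
qed

lemma char_of_nat_mult: "\<psi> (of_nat n * x) = \<psi> x ^ n"
proof (induction n)
  case (Suc n)
  have "\<psi> (of_nat (Suc n) * x) = \<psi> (x + of_nat n * x)" by (simp add: distrib_right)
  then show ?case using Suc by (simp add: char_add)
qed simp

lemma char_integer:
  assumes "vabs x \<le> 1"
  shows "\<psi> x = 1"
proof -
  have "1 \<in> annihilator \<psi> ring_of_integers"
    unfolding annihilator_integers by (simp add: ring_of_integers_def)
  then show ?thesis using assms by (auto simp: annihilator_def ring_of_integers_def)
qed

lemma char_trivial_imp_integer:
  assumes "\<And>z. vabs z \<le> 1 \<Longrightarrow> \<psi> (x * z) = 1"
  shows "vabs x \<le> 1"
proof -
  have "x \<in> annihilator \<psi> ring_of_integers" using assms by (simp add: annihilator_def ring_of_integers_def)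
  then show ?thesis unfolding annihilator_integers by (simp add: ring_of_integers_def)
qed

text \<open>For large \<open>k\<close> the multiple \<open>p ^ k * x\<close> is integral, so
  \<open>\<psi> x\<close> is a root of unity.\<close>

lemma vabs_char [simp]: "vabs (\<psi> x) = 1"
proof -
  obtain k where k: "vabs x < real p ^ k" using real_arch_pow[of "real p" "vabs x"] p_gt_1 by auto
  have "vabs (of_nat (p ^ k) * x) \<le> 1"
    using k p_gt_1 by (simp add: vabs_mult vabs_power vabs_p_domain field_simps)
  then have "\<psi> x ^ (p ^ k) = 1" using char_integer char_of_nat_mult by metis
  then show ?thesis using vabs_root_of_unity[of "\<psi> x" "p ^ k"] p_gt_1 by simp
qed

lemma schwartz_mult_char:
  assumes "schwartz f"
  shows "schwartz (\<lambda>x. \<psi> (b * x) * f x)"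
proof -
  obtain d where d: "level d f" using assms unfolding schwartz_def by blast
  \<comment> \<open>The second bound makes \<open>b * (x - y)\<close> integral for points at
    distance at most \<open>e\<close>, so the character factor does not change.\<close>
  define e where "e = min d (1 / (1 + vabs b))"
  have e: "0 < e" "e \<le> d" "e \<le> 1 / (1 + vabs b)"
    using d by (auto simp: e_def level_def add_pos_nonneg)
  note d' = level_mono[OF d e(1,2)]
  have "level e (\<lambda>x. \<psi> (b * x) * f x)"
    unfolding level_def
  proof (intro conjI allI impI)
    fix x y :: 'f assume xy: "dist x y \<le> e"
    have "vabs (b * (x - y)) \<le> vabs b * (1 / (1 + vabs b))"
      using xy e(3) unfolding vabs_mult dist_vabs by (intro mult_left_mono) auto
    also have "\<dots> \<le> 1" by (simp add: field_simps add_pos_nonneg)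
    finally have "\<psi> (b * (x - y)) = 1" by (rule char_integer)
    then have "\<psi> (b * x) = \<psi> (b * y)"
      using char_add[of "b * (x - y)" "b * y"] by (simp add: algebra_simps)
    moreover have "f x = f y" using d' xy unfolding level_def by blast
    ultimately show "\<psi> (b * x) * f x = \<psi> (b * y) * f y" by simp
  qed (use d' in \<open>auto simp: level_def\<close>)
  then show ?thesis unfolding schwartz_def by blast
qed

section \<open>Linearity and translation invariance of the integral\<close>

lemma distr_integral_add:
  assumes "schwartz f" "schwartz g"
  shows "distr_integral \<mu> (\<lambda>x. f x + g x) = distr_integral \<mu> f + distr_integral \<mu> g"
proof -
  obtain d where d: "level d f" "level d g" using schwartz_common_level[OF assms] .
  then have fg: "level d (\<lambda>x. f x + g x)"
    unfolding level_def by (metis add.right_neutral)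
  have d01: "0 < d" "d \<le> 1" using d by (auto simp: level_def)
  obtain R where R: "finite R" "cball 0 (1 / d) = (\<Union>a\<in>R. cball (a::'f) d)"
    "disjoint_family_on (\<lambda>a. cball a d) R" using ex_representatives[OF d01] by blast
  show ?thesis
    unfolding distr_integral_level[OF d(1) R] distr_integral_level[OF d(2) R] distr_integral_level[OF fg R]
    by (simp add: sum.distrib algebra_simps)
qed

lemma distr_integral_mult_const:
  assumes "schwartz f"
  shows "distr_integral \<mu> (\<lambda>x. c * f x) = c * distr_integral \<mu> f"
proof -
  obtain d where d: "level d f" using assms unfolding schwartz_def by blast
  then have cf: "level d (\<lambda>x. c * f x)" unfolding level_def by (metis mult_zero_right)
  have d01: "0 < d" "d \<le> 1" using d by (auto simp: level_def)
  obtain R where R: "finite R" "cball 0 (1 / d) = (\<Union>a\<in>R. cball (a::'f) d)"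
    "disjoint_family_on (\<lambda>a. cball a d) R" using ex_representatives[OF d01] by blast
  show ?thesis
    unfolding distr_integral_level[OF d R] distr_integral_level[OF cf R]
    by (simp add: mult.left_commute flip: sum_distrib_left)
qed

lemma distr_integral_translate:
  assumes "schwartz f"
  shows "distr_integral \<mu> (\<lambda>x. f (x - a)) = distr_integral \<mu> f"
proof -
  obtain d where d: "level d f" using assms unfolding schwartz_def by blast
  have d01: "0 < d" "d \<le> 1" using d by (auto simp: level_def)
  obtain R where R: "finite R" "cball 0 (1 / d) = (\<Union>a\<in>R. cball (a::'f) d)"
    "disjoint_family_on (\<lambda>a. cball a d) R" using ex_representatives[OF d01] by blast
  have "range (\<lambda>x. x - a) = UNIV" by (metis add_diff_cancel_right' surj_def)
  then have rng: "range (\<lambda>x. f (x - a)) = range f" by (metis image_image)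
  have "\<mu> ((\<lambda>x. f (x - a)) -` {c}) = \<mu> (f -` {c})" if "c \<noteq> 0" for c
  proof -
    have "(\<lambda>x. f (x - a)) -` {c} = (+) a ` (f -` {c})"
    proof (intro equalityI subsetI)
      fix x assume "x \<in> (\<lambda>x. f (x - a)) -` {c}"
      then have "a + (x - a) \<in> (+) a ` (f -` {c})" by (intro imageI) simp
      then show "x \<in> (+) a ` (f -` {c})" by simp
    qed auto
    moreover have "compact (f -` {c}) \<and> open (f -` {c})"
      unfolding level_fibre[OF d R(2) that] using R(1) d01 by (auto intro!: compact_UN open_UN compact_cball open_cball_nonarch)
    ultimately show ?thesis using haar_translate by simp
  qed
  then show ?thesis unfolding distr_integral_def rng by (intro sum.cong) auto
qed

section \<open>The Fourier transform\<close>


abbreviation fourier :: "('f \<Rightarrow> 'c) \<Rightarrow> 'f \<Rightarrow> 'c" where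
  "fourier \<equiv> fourier_transform \<mu> \<psi>"

lemma schwartz_mult_char': "schwartz f \<Longrightarrow> schwartz (\<lambda>y. f y * \<psi> (x * y))"
  using schwartz_mult_char[of f x] by (simp add: mult.commute)

lemma fourier_add:
  assumes "schwartz f" "schwartz g"
  shows "fourier (\<lambda>y. f y + g y) x = fourier f x + fourier g x"
  using distr_integral_add[OF assms[THEN schwartz_mult_char', of x]]
  by (simp add: fourier_transform_def algebra_simps)

lemma fourier_mult_const:
  assumes "schwartz f"
  shows "fourier (\<lambda>y. c * f y) x = c * fourier f x"
  using distr_integral_mult_const[OF schwartz_mult_char'[OF assms], of c x]
  by (simp add: fourier_transform_def mult.assoc)

lemma fourier_zero: "fourier (\<lambda>y. 0) x = 0"
  using fourier_mult_const[OF schwartz_zero, of 0 x] by simp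

lemma fourier_sum:
  assumes "\<And>i. i \<in> A \<Longrightarrow> schwartz (f i)"
  shows "fourier (\<lambda>y. \<Sum>i\<in>A. f i y) x = (\<Sum>i\<in>A. fourier (f i) x)"
  using assms
  by (induction A rule: infinite_finite_induct) (auto simp: fourier_zero fourier_add schwartz_sum)

lemma fourier_mult_char: "fourier (\<lambda>y. \<psi> (b * y) * f y) x = fourier f (x + b)"
  by (simp add: fourier_transform_def char_add algebra_simps)

lemma fourier_translate:
  assumes "schwartz f"
  shows "fourier (\<lambda>y. f (y - a)) x = \<psi> (x * a) * fourier f x"
proof -
  define g where "g = (\<lambda>y. f y * \<psi> (x * y))"
  have g: "schwartz g" unfolding g_def by (rule schwartz_mult_char'[OF assms])
  have "f (y - a) * \<psi> (x * y) = \<psi> (x * a) * g (y - a)" for y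
    using char_add[of "x * a" "x * (y - a)"] by (simp add: g_def algebra_simps)
  then have "fourier (\<lambda>y. f (y - a)) x = distr_integral \<mu> (\<lambda>y. \<psi> (x * a) * g (y - a))"
    by (simp add: fourier_transform_def)
  also have "\<dots> = \<psi> (x * a) * distr_integral \<mu> g"
    by (simp add: distr_integral_mult_const[OF schwartz_translate[OF g]] distr_integral_translate[OF g])
  finally show ?thesis by (simp add: fourier_transform_def g_def)
qed

text \<open>The ball is a subgroup. If the character at \<open>x\<close> is trivial on it, the
  transform is its volume. Otherwise translation by some \<open>a\<close> in the ball fixes the
  indicator but multiplies the transform by \<open>\<psi> (x * a) \<noteq> 1\<close>, so the
  transform vanishes.\<close>

lemma vabs_fourier_indicator_le:
  assumes "e > 0"
  shows "vabs (fourier (indicator (cball 0 e)) x) \<le> vabs (\<mu> (cball 0 e))"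
proof (cases "\<forall>y\<in>cball 0 e. \<psi> (x * y) = 1")
  case True
  define f where "f = (indicator (cball 0 e) :: 'f \<Rightarrow> 'c)"
  have "f y * \<psi> (x * y) = f y" for y using True by (auto simp: f_def indicator_def)
  then have "(\<lambda>y. f y * \<psi> (x * y)) = f" by (rule ext)
  then have "fourier f x = distr_integral \<mu> f" by (simp add: fourier_transform_def)
  moreover have "f 0 = 1" using assms by (simp add: f_def)
  then have "range f - {0} = {1}"
    using rangeI[of f 0] by (auto simp: f_def indicator_def)
  moreover have "f -` {1} = cball 0 e" by (auto simp: f_def indicator_def split: if_splits)
  ultimately show ?thesis by (simp add: distr_integral_def f_def)
next
  case False
  then obtain a where a: "a \<in> cball 0 e" "\<psi> (x * a) \<noteq> 1" by blast
  define f where "f = (indicator (cball 0 e) :: 'f \<Rightarrow> 'c)"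
  have "y - a \<in> cball 0 e \<longleftrightarrow> y \<in> cball 0 e" for y
  proof -
    have "y - a \<in> cball 0 e \<longleftrightarrow> y \<in> cball a e" by (simp add: dist_vabs_swap)
    then show ?thesis using cball_eq_of_mem[OF a(1)] by simp
  qed
  then have "(\<lambda>y. f (y - a)) = f" by (auto simp: f_def indicator_def)
  then have "fourier f x = \<psi> (x * a) * fourier f x"
    using fourier_translate[OF schwartz_indicator[OF assms], of a x] by (simp add: f_def)
  then have "(\<psi> (x * a) - 1) * fourier f x = 0" by (simp add: algebra_simps)
  then have "fourier f x = 0" using a(2) by simp
  then show ?thesis by (simp add: f_def)
qed

text \<open>
  The character \<open>y \<mapsto> \<psi>(p\<^sup>k y)\<close> splits \<open>p\<^bsup>-k-1\<^esup>O\<close> into \<open>p\<close> translates of the same union of cosets of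
  \<open>p\<^bsup>-k\<^esup>O\<close>, so that the index is divisible by \<open>p\<close>.
\<close>

lemma haar_cball_step:
  "vabs (\<mu> (cball 0 (real p ^ Suc k))) \<le> 1 / p * vabs (\<mu> (cball 0 (real p ^ k)))"
proof -
  define A where "A = cball (0::'f) (real p ^ Suc k)"
  define e where "e = real p ^ k"
  define \<rho> where "\<rho> y = \<psi> (of_nat (p ^ k) * y)" for y
  have e0: "e > 0" using p_gt_1 by (simp add: e_def)
  have vpk: "vabs (of_nat (p ^ k) :: 'f) = 1 / e"
    by (simp add: e_def vabs_power vabs_p_domain power_one_over)
  have A_iff: "y \<in> A \<longleftrightarrow> vabs y \<le> p * e" for y by (simp add: A_def e_def dist_vabs_swap)
  have \<rho>_add: "\<rho> (x + y) = \<rho> x * \<rho> y" for x y by (simp add: \<rho>_def algebra_simps char_add)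
  have \<rho>_trivial: "\<rho> y = 1" if "vabs y \<le> e" for y
    unfolding \<rho>_def using that e0 by (intro char_integer) (simp add: vabs_mult vpk del: of_nat_power)
  have \<rho>_p: "\<rho> y ^ p = 1" if "y \<in> A" for y
  proof -
    have "\<rho> y ^ p = \<psi> (of_nat p * (of_nat (p ^ k) * y))" unfolding \<rho>_def by (rule char_of_nat_mult[symmetric])
    also have "\<dots> = 1"
      using that e0 p_gt_1 by (intro char_integer) (simp add: A_iff vabs_mult vpk vabs_p_domain field_simps del: of_nat_power)
    finally show ?thesis .
  qed
  \<comment> \<open>If \<open>\<rho>\<close> were trivial on \<open>A\<close>, then
    \<open>1 / p\<close> would annihilate the ring of integers and hence lie in it.\<close>
  obtain y\<^sub>0 where y0: "y\<^sub>0 \<in> A" "\<rho> y\<^sub>0 \<noteq> 1"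
  proof (rule ccontr)
    assume "\<not> thesis"
    then have triv: "\<rho> y = 1" if "y \<in> A" for y using that \<open>\<And>y. y \<in> A \<Longrightarrow> \<rho> y \<noteq> 1 \<Longrightarrow> thesis\<close> by blast
    have "\<psi> (1 / of_nat p * z) = 1" if "vabs z \<le> 1" for z
    proof -
      have "\<rho> (z / of_nat (p ^ Suc k)) = 1"
        using that p_gt_1 e0 by (intro triv) (simp add: A_iff vabs_divide vabs_mult vabs_power vabs_p_domain e_def field_simps)
      then show ?thesis by (simp add: \<rho>_def)
    qed
    then have "vabs (1 / of_nat p :: 'f) \<le> 1" by (rule char_trivial_imp_integer)
    then show False using p_gt_1 by (simp add: vabs_divide vabs_p_domain)
  qed
  define \<omega> where "\<omega> = \<rho> y\<^sub>0"
  have prim: "primitive_root_of_unity p \<omega>"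
    using primitive_root_of_unity_prime_powerI[OF p, of \<omega> 0] \<rho>_p[OF y0(1)] y0(2) by (simp add: \<omega>_def)
  have inj: "inj_on (\<lambda>i. \<omega> ^ i) {..<p}"
    using primitive_root_of_unity_inj_on[OF prim] p_gt_1 by simp
  have \<omega>1: "\<omega> ^ p = 1" using \<rho>_p[OF y0(1)] by (simp add: \<omega>_def)
  have A_add: "x + y \<in> A" if "x \<in> A" "y \<in> A" for x y using that by (auto simp: A_iff intro: vabs_add_le)
  have A_diff: "x - y \<in> A" if "x \<in> A" "y \<in> A" for x y using that by (auto simp: A_iff intro: vabs_diff_le)
  have y0A: "of_nat i * y\<^sub>0 \<in> A" for i
    by (induction i) (use y0(1) e0 in \<open>auto simp: algebra_simps A_iff intro: vabs_add_le\<close>)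
  have \<rho>_y0: "\<rho> (of_nat i * y\<^sub>0) = \<omega> ^ i" for i
  proof (induction i)
    case 0
    show ?case using \<rho>_trivial[of 0] e0 by simp
  qed (simp add: algebra_simps \<rho>_add \<omega>_def)
  have "vabs y \<le> e \<Longrightarrow> y \<in> A" for y using p_gt_1 e0 by (auto simp: A_iff intro: order_trans[of _ e])
  then have "cball x e \<subseteq> A" if "x \<in> A" for x
    using A_add[OF that, of "_ - x"] by (force simp: dist_vabs_swap)
  then obtain R where R: "finite R" "R \<subseteq> A" "A = (\<Union>a\<in>R. cball a e)" "disjoint_family_on (\<lambda>a. cball a e) R"
    using finite_cball_partition[of A e] compact_cball e0 unfolding A_def by metis
  define A' where "A' i = {y \<in> A. \<rho> y = \<omega> ^ i}" for i
  have A'_eq: "A' i = (\<Union>a\<in>{a\<in>R. \<rho> a = \<omega> ^ i}. cball a e)" for i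
  proof -
    have "\<rho> y = \<rho> a" if "y \<in> cball a e" for y a
      using \<rho>_add[of a "y - a"] \<rho>_trivial[of "y - a"] that by (simp add: dist_vabs_swap)
    then have "y \<in> A \<and> \<rho> y = \<omega> ^ i \<longleftrightarrow> (\<exists>a\<in>R. \<rho> a = \<omega> ^ i \<and> y \<in> cball a e)" for y
      by (subst R(3)) auto
    then show ?thesis unfolding A'_def by auto
  qed
  have A'_compact_open: "compact (A' i) \<and> open (A' i)" for i
    unfolding A'_eq using R(1) e0 by (auto intro!: compact_UN open_UN compact_cball open_cball_nonarch)
  have A'_translate: "A' i = (+) (of_nat i * y\<^sub>0) ` A' 0" for i
  proof (intro equalityI subsetI)
    fix y assume y: "y \<in> A' i"
    have "\<rho> y = \<rho> (of_nat i * y\<^sub>0) * \<rho> (y - of_nat i * y\<^sub>0)" by (simp flip: \<rho>_add)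
    then have "\<omega> ^ i * \<rho> (y - of_nat i * y\<^sub>0) = \<omega> ^ i * 1" using y by (simp add: A'_def \<rho>_y0)
    moreover have "\<omega> ^ i \<noteq> 0" by (simp add: \<omega>_def \<rho>_def)
    ultimately have "y - of_nat i * y\<^sub>0 \<in> A' 0"
      using y A_diff y0A unfolding mult_left_cancel[OF \<open>\<omega> ^ i \<noteq> 0\<close>] by (auto simp: A'_def)
    then have "of_nat i * y\<^sub>0 + (y - of_nat i * y\<^sub>0) \<in> (+) (of_nat i * y\<^sub>0) ` A' 0" by (rule imageI)
    then show "y \<in> (+) (of_nat i * y\<^sub>0) ` A' 0" by simp
  qed (auto simp: A'_def \<rho>_add \<rho>_y0 intro: A_add y0A)
  have "A = (\<Union>i\<in>{..<p}. A' i)"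
  proof (intro equalityI subsetI)
    fix y assume y: "y \<in> A"
    obtain j where "j < p" "\<rho> y = \<omega> ^ j"
      using root_of_unity_is_power[OF \<omega>1 inj _ \<rho>_p[OF y]] p_gt_1 by auto
    then show "y \<in> (\<Union>i\<in>{..<p}. A' i)" using y by (auto simp: A'_def)
  qed (auto simp: A'_def)
  moreover have "disjoint_family_on A' {..<p}"
    unfolding disjoint_family_on_def
  proof (intro ballI impI)
    fix i j assume "i \<in> {..<p}" "j \<in> {..<p}" "i \<noteq> j"
    then have "\<omega> ^ i \<noteq> \<omega> ^ j" using inj by (meson inj_onD)
    then show "A' i \<inter> A' j = {}" by (auto simp: A'_def)
  qed
  moreover have \<mu>_A': "\<mu> (A' i) = \<mu> (A' 0)" for i
    unfolding A'_translate[of i] using A'_compact_open by (intro haar_translate) auto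
  ultimately have "\<mu> A = (\<Sum>i<p. \<mu> (A' i))"
    using haar_UN[of "{..<p}" A'] A'_compact_open by simp
  also have "\<dots> = (\<Sum>i<p. \<mu> (A' 0))" by (intro sum.cong refl \<mu>_A')
  also have "\<dots> = of_nat p * \<mu> (A' 0)" by simp
  \<comment> \<open>\<open>A' 0\<close> is a finite disjoint union of balls of radius
    \<open>e\<close>, and their number, being a natural number, has absolute value at most
    1.\<close>
  also have "\<mu> (A' 0) = of_nat (card {a\<in>R. \<rho> a = \<omega> ^ 0}) * \<mu> (cball 0 e)"
    unfolding A'_eq using R e0 by (intro haar_UN_cball) (auto simp: disjoint_family_on_def)
  finally have "vabs (\<mu> A) = 1 / p * (vabs (of_nat (card {a\<in>R. \<rho> a = \<omega> ^ 0}) :: 'c) * vabs (\<mu> (cball 0 e)))"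
    by (simp add: vabs_mult vabs_p)
  also have "\<dots> \<le> 1 / p * (1 * vabs (\<mu> (cball 0 e)))"
    by (intro mult_left_mono mult_right_mono vabs_of_nat_le) auto
  finally show ?thesis by (simp add: A_def e_def)
qed

lemma vabs_haar_cball_le: "vabs (\<mu> (cball 0 (real p ^ k))) \<le> (1 / p) ^ k"
proof (induction k)
  case (Suc k)
  have "vabs (\<mu> (cball 0 (real p ^ Suc k))) \<le> 1 / p * vabs (\<mu> (cball 0 (real p ^ k)))"
    by (rule haar_cball_step)
  also have "\<dots> \<le> 1 / p * (1 / p) ^ k" using Suc by (intro mult_left_mono) auto
  finally show ?case by simp
qed simp

text \<open>\<open>K\<close> bounds the operator norm of multiplication by \<open>u\<close> when
  functions are measured by the sup norm of their transforms. Quantifying over all pointwise bounds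
  \<open>B\<close> avoids suprema and makes composition immediate.\<close>

definition multiplier :: "real \<Rightarrow> ('f \<Rightarrow> 'c) \<Rightarrow> bool" where
  "multiplier K u \<longleftrightarrow> (\<forall>f B. schwartz f \<and> (\<forall>x. vabs (fourier f x) \<le> B) \<longrightarrow>
     schwartz (\<lambda>y. u y * f y) \<and> (\<forall>x. vabs (fourier (\<lambda>y. u y * f y) x) \<le> K * B))"

text \<open>Multiplication by a character translates the transform and multiplication by
  \<open>\<eta>\<close> preserves its size, so by the ultrametric inequality only the denominator
  costs anything.\<close>

lemma multiplier_char_factor:
  assumes "vabs \<eta> = 1"
  shows "multiplier (1 / vabs (1 - \<eta>)) (\<lambda>y. (\<psi> (b * y) - \<eta>) / (1 - \<eta>))"
  unfolding multiplier_def
proof (intro allI impI, elim conjE)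
  fix f :: "'f \<Rightarrow> 'c" and B assume f: "schwartz f" and B: "\<forall>x. vabs (fourier f x) \<le> B"
  define g where "g y = \<psi> (b * y) * f y + (- \<eta>) * f y" for y
  have g: "schwartz g"
    unfolding g_def by (intro schwartz_add schwartz_mult_char schwartz_mult_const f)
  have eq: "(\<lambda>y. (\<psi> (b * y) - \<eta>) / (1 - \<eta>) * f y) = (\<lambda>y. 1 / (1 - \<eta>) * g y)"
    by (auto simp: g_def algebra_simps diff_divide_distrib)
  have "vabs (fourier g x) \<le> B" for x
  proof -
    have "fourier g x = fourier f (x + b) + (- \<eta>) * fourier f x"
      unfolding g_def fourier_add[OF schwartz_mult_char[OF f] schwartz_mult_const[OF f]]
        fourier_mult_char fourier_mult_const[OF f] ..
    then show ?thesis using B assms by (auto simp: vabs_mult intro!: vabs_diff_le)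
  qed
  then have "vabs (fourier (\<lambda>y. 1 / (1 - \<eta>) * g y) x) \<le> 1 / vabs (1 - \<eta>) * B" for x
    unfolding fourier_mult_const[OF g] vabs_mult vabs_divide vabs_1 by (intro mult_left_mono) auto
  then show "schwartz (\<lambda>y. (\<psi> (b * y) - \<eta>) / (1 - \<eta>) * f y) \<and>
    (\<forall>x. vabs (fourier (\<lambda>y. (\<psi> (b * y) - \<eta>) / (1 - \<eta>) * f y) x) \<le> 1 / vabs (1 - \<eta>) * B)"
    unfolding eq using schwartz_mult_const[OF g] by blast
qed

lemma multiplier_prod:
  assumes "\<And>i. i \<in> A \<Longrightarrow> multiplier (K i) (u i)"
  shows "multiplier (\<Prod>i\<in>A. K i) (\<lambda>y. \<Prod>i\<in>A. u i y)"
  using assms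
proof (induction A rule: infinite_finite_induct)
  case (insert a A)
  have a: "multiplier (K a) (u a)" and A: "multiplier (\<Prod>i\<in>A. K i) (\<lambda>y. \<Prod>i\<in>A. u i y)"
    using insert by auto
  show ?case
    unfolding multiplier_def
  proof (intro allI impI, elim conjE)
    fix f :: "'f \<Rightarrow> 'c" and B assume "schwartz f" and "\<forall>x. vabs (fourier f x) \<le> B"
    with A have "schwartz (\<lambda>y. (\<Prod>i\<in>A. u i y) * f y)"
      "\<forall>x. vabs (fourier (\<lambda>y. (\<Prod>i\<in>A. u i y) * f y) x) \<le> (\<Prod>i\<in>A. K i) * B"
      unfolding multiplier_def by blast+
    with a have "schwartz (\<lambda>y. u a y * ((\<Prod>i\<in>A. u i y) * f y)) \<and>
      (\<forall>x. vabs (fourier (\<lambda>y. u a y * ((\<Prod>i\<in>A. u i y) * f y)) x) \<le> K a * ((\<Prod>i\<in>A. K i) * B))"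
      unfolding multiplier_def by blast
    then show "schwartz (\<lambda>y. (\<Prod>i\<in>insert a A. u i y) * f y) \<and>
      (\<forall>x. vabs (fourier (\<lambda>y. (\<Prod>i\<in>insert a A. u i y) * f y) x) \<le> (\<Prod>i\<in>insert a A. K i) * B)"
      using insert by (simp add: mult.assoc)
  qed
qed (auto simp: multiplier_def)

section \<open>Approximation of indicator functions\<close>


text \<open>Finitely many characters, one for each representative modulo \<open>p\<close> whatever
  \<open>M\<close> is, detect the small ball inside the large one. To get from representatives to
  all integral \<open>z\<close>, write \<open>z = g + p w\<close>: the value at
  \<open>p ^ k * z\<close> is a power of the value for \<open>g\<close> times the value at
  \<open>p ^ Suc k * w\<close>. So triviality descends from exponent \<open>n + M\<close>, where
  integrality forces it, to exponent 0.\<close>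

lemma indicator_test_characters:
  assumes G: "cball 0 1 = (\<Union>g\<in>G. cball g (1 / p))"
    and y: "vabs y \<le> real p ^ M"
    and triv: "\<And>g. g \<in> G \<Longrightarrow> \<psi> (g / of_nat p ^ n * y) = 1"
  shows "vabs y \<le> (1 / p) ^ n"
proof -
  define N where "N = n + M"
  have p0: "real p > 0" using p_gt_1 by simp
  have "\<forall>z. vabs z \<le> 1 \<longrightarrow> \<psi> (of_nat (p ^ (N - i)) * (z / of_nat p ^ n * y)) = 1" if "i \<le> N" for i
    using that
  proof (induction i)
    case 0
    show ?case
    proof (intro allI impI)
      fix z :: 'f assume z: "vabs z \<le> 1"
      have "of_nat (p ^ (N - 0)) * (z / of_nat p ^ n * y) = of_nat p ^ M * z * y"
        by (simp add: N_def power_add)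
      also have "\<psi> \<dots> = 1"
      proof (rule char_integer)
        have "vabs z * vabs y \<le> 1 * real p ^ M" using z y by (intro mult_mono) auto
        then show "vabs (of_nat p ^ M * z * y) \<le> 1"
          using p0 by (simp add: vabs_mult vabs_power vabs_p_domain field_simps)
      qed
      finally show "\<psi> (of_nat (p ^ (N - 0)) * (z / of_nat p ^ n * y)) = 1" .
    qed
  next
    case (Suc i)
    define k where "k = N - Suc i"
    have k: "N - i = Suc k" using Suc.prems by (simp add: k_def)
    show ?case
      unfolding k_def[symmetric]
    proof (intro allI impI)
      fix z :: 'f assume "vabs z \<le> 1"
      then have "z \<in> cball 0 1" by (simp add: dist_vabs_swap)
      then obtain g where g: "g \<in> G" "vabs (z - g) \<le> 1 / p" unfolding G by (auto simp: dist_vabs_swap)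
      define w where "w = (z - g) / of_nat p"
      have w: "vabs w \<le> 1" using g(2) p0 by (simp add: w_def vabs_divide vabs_p_domain field_simps)
      have z: "z = g + of_nat p * w" by (simp add: w_def)
      have "of_nat (p ^ k) * (z / of_nat p ^ n * y) =
        of_nat (p ^ k) * (g / of_nat p ^ n * y) + of_nat (p ^ Suc k) * (w / of_nat p ^ n * y)"
        unfolding z by (simp add: field_simps)
      then have "\<psi> (of_nat (p ^ k) * (z / of_nat p ^ n * y)) =
        \<psi> (g / of_nat p ^ n * y) ^ (p ^ k) * \<psi> (of_nat (p ^ Suc k) * (w / of_nat p ^ n * y))"
        by (simp only: char_add char_of_nat_mult)
      also have "\<dots> = 1" using triv[OF g(1)] Suc w by (simp add: k del: of_nat_power power_Suc)
      finally show "\<psi> (of_nat (p ^ k) * (z / of_nat p ^ n * y)) = 1" .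
    qed
  qed
  from this[of N] have "\<psi> (y / of_nat p ^ n * z) = 1" if "vabs z \<le> 1" for z
    using that by (simp add: mult.commute[of y])
  then have "vabs (y / of_nat p ^ n) \<le> 1" by (rule char_trivial_imp_integer)
  then show ?thesis using p0 by (simp add: vabs_divide vabs_power vabs_p_domain field_simps)
qed

lemma ex_approx_indicator:
  obtains r :: real where "0 \<le> r" "r < 1"
    "\<And>n \<epsilon>. \<epsilon> > 0 \<Longrightarrow> \<exists>g. schwartz g \<and> (\<forall>y. vabs (indicator (cball 0 ((1 / p) ^ n)) y - g y) \<le> r) \<and>
       (\<forall>x. vabs (fourier g x) \<le> \<epsilon>)"
proof -
  have p0: "real p > 0" and p1: "real p > 1" using p_gt_1 by simp_all
  have "cball x (1 / p) \<subseteq> cball 0 1" if "x \<in> cball (0::'f) 1" for x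
    using cball_eq_of_mem[OF that] subset_cball[of "1 / p" 1 x] p1 by auto
  then obtain G where G: "finite G" "G \<subseteq> cball (0::'f) 1" "cball 0 1 = (\<Union>g\<in>G. cball g (1 / p))"
    using finite_cball_partition[of "cball (0::'f) 1" "1 / p"] compact_cball p0 by (metis zero_less_divide_1_iff)
  \<comment> \<open>A product of \<open>card G\<close> factors will cost at most the square root of
    \<open>p ^ N\<close>. Since \<open>c\<close> depends on \<open>G\<close> alone, \<open>r\<close>
    depends on neither \<open>n\<close> nor \<epsilon>.\<close>
  obtain c where "2 * real (card G) < real p ^ c" using real_arch_pow[OF p1] by blast
  then have c: "2 * card G \<le> p ^ c" by (metis less_imp_le of_nat_le_iff of_nat_mult of_nat_numeral of_nat_power)
  define r where "r = root (p ^ Suc c) (1 / p)"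
  have pc: "p ^ Suc c > 0" using p_gt_1 by simp
  have r: "r \<ge> 0" "r ^ (p ^ Suc c) = 1 / p"
    using pc p0 by (auto simp: r_def simp del: power_Suc)
  have r1: "r < 1" using pc p1 by (simp add: r_def real_root_lt_1_iff del: power_Suc)
  have approx: "\<exists>g. schwartz g \<and> (\<forall>y. vabs (indicator (cball 0 ((1 / p) ^ n)) y - g y) \<le> r) \<and>
       (\<forall>x. vabs (fourier g x) \<le> \<epsilon>)" if \<epsilon>: "\<epsilon> > 0" for n and \<epsilon> :: real
  proof -
    have "\<epsilon>\<^sup>2 / real p ^ n > 0" using \<epsilon> p0 by simp
    \<comment> \<open>The square of the final bound on the transform is at most
      \<open>p ^ n * (1 / p) ^ M\<close>. Taking \<open>M = Suc M'\<close> ensures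
      \<open>N \<ge> 1\<close>.\<close>
    then obtain M' where "(1 / p) ^ M' < \<epsilon>\<^sup>2 / real p ^ n" using real_arch_pow_inv[of _ "1 / p"] p1 by auto
    moreover have "(1 / real p) ^ Suc M' \<le> (1 / p) ^ M'" using p1 by (intro power_decreasing) auto
    moreover define M where "M = Suc M'"
    ultimately have "(1 / real p) ^ M < \<epsilon>\<^sup>2 / real p ^ n" and M1: "M \<ge> 1" by simp_all
    then have M: "real p ^ n * (1 / p) ^ M < \<epsilon>\<^sup>2" using p0 by (simp add: field_simps)
    define N where "N = n + M"
    have N1: "N \<ge> 1" using M1 by (simp add: N_def)
    obtain \<zeta> :: 'c where prim: "primitive_root_of_unity (p ^ (N + c)) \<zeta>"
      using ex_primitive_root_of_unity_prime_power[OF p] p_nonzero by metis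
    interpret prime_power_root_of_unity p N c \<zeta> r
      by unfold_locales (use p vabs_p N1 prim r in auto)
    define D where "D = (\<Prod>i\<in>{1..<p ^ N}. vabs (1 - \<zeta> ^ i))"
    have Dpos: "D > 0"
      unfolding D_def using outer_root_pos not_dvd_index by (intro prod_pos) (auto simp: vabs_minus_commute[of 1])
    define K where "K = (1 / D) ^ card G"
    \<comment> \<open>On the ball of radius \<open>p ^ M\<close> the values
      \<open>\<psi> (b g * y)\<close> are roots of unity of order dividing
      \<open>p ^ (N + c)\<close>. Their \<open>p ^ c\<close>-th powers are the test characters of
      \<open>indicator_test_characters\<close>, so the value is an inner root exactly when the test
      character is 1 at \<open>y\<close>.\<close>
    define b where "b g = g / of_nat p ^ (n + c)" for g :: 'f
    define \<Theta> where "\<Theta> y = (\<Prod>g\<in>G. \<theta> (\<psi> (b g * y)))" for y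
    define h where "h y = \<Theta> y * indicator (cball 0 (real p ^ M)) y" for y
    have "multiplier (\<Prod>i\<in>{1..<p ^ N}. 1 / vabs (1 - \<zeta> ^ i)) (\<lambda>y. \<theta> (\<psi> (b g * y)))" for g
      unfolding \<theta>_def by (intro multiplier_prod multiplier_char_factor) (simp add: vabs_power)
    then have "multiplier (1 / D) (\<lambda>y. \<theta> (\<psi> (b g * y)))" for g
      by (simp add: D_def prod_dividef)
    then have "multiplier (\<Prod>g\<in>G. 1 / D) \<Theta>"
      unfolding \<Theta>_def by (rule multiplier_prod)
    then have mult: "multiplier K \<Theta>" by (simp add: K_def)
    have ind: "schwartz (indicator (cball 0 (real p ^ M)))" using p0 by (intro schwartz_indicator) simp
    have "vabs (fourier (indicator (cball 0 (real p ^ M))) x) \<le> (1 / p) ^ M" for x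
      using vabs_fourier_indicator_le[of "real p ^ M" x] vabs_haar_cball_le[of M] p0 by simp
    with mult ind have h: "schwartz h" and Fh: "\<And>x. vabs (fourier h x) \<le> K * (1 / p) ^ M"
      unfolding multiplier_def h_def by blast+
    have "K * (1 / p) ^ M \<le> \<epsilon>"
    proof (rule power2_le_imp_le)
      \<comment> \<open>Raising to the power \<open>p ^ c\<close> turns \<open>1 / D\<close> into
        \<open>p ^ N\<close>, by \<open>denominator_power\<close>; then
        \<open>2 * card G \<le> p ^ c\<close> yields \<open>K\<^sup>2 \<le> p ^ N\<close>.\<close>
      have "(K\<^sup>2) ^ (p ^ c) = ((1 / D) ^ (p ^ c)) ^ (2 * card G)"
        unfolding K_def by (simp only: mult.commute mult.left_commute flip: power_mult)
      also have "(1 / D) ^ (p ^ c) = real p ^ N"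
        using denominator_power p0 unfolding D_def by (simp add: power_divide)
      also have "(real p ^ N) ^ (2 * card G) \<le> (real p ^ N) ^ (p ^ c)"
        using c p1 by (intro power_increasing) auto
      finally have "K\<^sup>2 \<le> real p ^ N" using p_gt_1 by (simp add: power_mono_iff)
      then have "K\<^sup>2 * ((1 / p) ^ M)\<^sup>2 \<le> real p ^ N * ((1 / p) ^ M)\<^sup>2" by (intro mult_right_mono) auto
      also have "\<dots> = real p ^ n * (1 / p) ^ M"
        using p0 by (simp add: N_def power_add power2_eq_square power_divide)
      finally show "(K * (1 / p) ^ M)\<^sup>2 \<le> \<epsilon>\<^sup>2" using M by (simp add: power_mult_distrib)
    qed (use \<epsilon> in simp)
    then have "vabs (fourier h x) \<le> \<epsilon>" for x using Fh order_trans by blast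
    moreover have "vabs (indicator (cball 0 ((1 / p) ^ n)) y - h y) \<le> r" for y
    proof (cases "vabs y \<le> real p ^ M")
      case False
      have "(1 / real p) ^ n \<le> 1" using p1 by (intro power_le_one) auto
      also have "1 \<le> real p ^ M" using p1 by (intro one_le_power) auto
      finally show ?thesis using False r(1) by (simp add: h_def indicator_def dist_vabs_swap)
    next
      case True
      then have hy: "h y = \<Theta> y" by (simp add: h_def dist_vabs_swap)
      have "\<exists>j. \<psi> (b g * y) = \<zeta> ^ j" if "g \<in> G" for g
      proof -
        have "vabs g \<le> 1" using that G(2) by (auto simp: dist_vabs_swap)
        then have "vabs g * vabs y \<le> 1 * real p ^ M" using True by (intro mult_mono) auto
        then have "vabs (of_nat p ^ M * (g * y)) \<le> 1"
          using p0 by (simp add: vabs_mult vabs_power vabs_p_domain field_simps)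
        moreover have "of_nat (p ^ (N + c)) * (b g * y) = of_nat p ^ M * (g * y)"
          by (simp add: b_def N_def power_add)
        ultimately have "\<psi> (b g * y) ^ (p ^ (N + c)) = 1"
          unfolding char_of_nat_mult[symmetric] by (metis char_integer)
        then show ?thesis
          using root_of_unity_is_power[of \<zeta> "p ^ (N + c)"] primitive_root_of_unity_inj_on[OF prim]
            root_power p_gt_1 by (metis dvd_refl zero_less_power less_trans zero_less_one)
      qed
      then obtain j where j: "\<And>g. g \<in> G \<Longrightarrow> \<psi> (b g * y) = \<zeta> ^ j g" by metis
      have test: "\<psi> (g / of_nat p ^ n * y) = 1 \<longleftrightarrow> p ^ N dvd j g" if "g \<in> G" for g
      proof -
        have "g / of_nat p ^ n * y = of_nat (p ^ c) * (b g * y)" by (simp add: b_def power_add)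
        then have "\<psi> (g / of_nat p ^ n * y) = \<zeta> ^ (j g * p ^ c)"
          by (simp only: char_of_nat_mult j[OF that] power_mult)
        then show ?thesis using p_gt_1 by (simp add: root_power power_add)
      qed
      show ?thesis
      proof (cases "vabs y \<le> (1 / p) ^ n")
        case True
        have "vabs (\<theta> (\<psi> (b g * y)) - 1) \<le> r" if "g \<in> G" for g
        proof -
          have "vabs g \<le> 1" using that G(2) by (auto simp: dist_vabs_swap)
          then have "vabs g * vabs y \<le> 1 * (1 / p) ^ n" using True by (intro mult_mono) auto
          then have "\<psi> (g / of_nat p ^ n * y) = 1"
            using p0 by (intro char_integer) (simp add: vabs_mult vabs_divide vabs_power vabs_p_domain field_simps)
          then show ?thesis using test[OF that] j[OF that] \<theta>_inner by simp
        qed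
        then have "vabs (\<Theta> y - 1) \<le> r"
          unfolding \<Theta>_def using r(1) r1 by (intro vabs_prod_diff_1_le) auto
        then show ?thesis using True hy by (simp add: dist_vabs_swap vabs_minus_commute)
      next
        case False
        then obtain g where g: "g \<in> G" "\<not> p ^ N dvd j g"
          using indicator_test_characters[OF G(3) \<open>vabs y \<le> real p ^ M\<close>] test by blast
        \<comment> \<open>One nontrivial test character makes its factor at most \<open>r\<close>;
          it remains that no other factor exceeds 1.\<close>
        have le1: "vabs (\<theta> (\<psi> (b g * y))) \<le> 1" if "g \<in> G" for g
        proof (cases "p ^ N dvd j g")
          case True
          then have "vabs (\<theta> (\<psi> (b g * y)) - 1) \<le> 1" using \<theta>_inner[OF True] j[OF that] r1 by simp
          then show ?thesis using vabs_add_le[of "\<theta> (\<psi> (b g * y)) - 1" 1 1] by simp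
        next
          case False
          then show ?thesis using \<theta>_outer[OF False] j[OF that] r1 by simp
        qed
        have "vabs (\<Theta> y) = vabs (\<theta> (\<psi> (b g * y))) * (\<Prod>g\<in>G - {g}. vabs (\<theta> (\<psi> (b g * y))))"
          unfolding \<Theta>_def vabs_prod using G(1) g(1) by (rule prod.remove)
        also have "\<dots> \<le> r * 1"
          using le1 \<theta>_outer[OF g(2)] j[OF g(1)] r(1)
          by (intro mult_mono prod_le_1 prod_nonneg) auto
        finally show ?thesis using False hy by (simp add: dist_vabs_swap)
      qed
    qed
    ultimately show ?thesis using h by blast
  qed
  show ?thesis by (rule that[OF r(1) r1 approx])
qed

section \<open>From indicator functions to all Schwartz functions\<close>

lemma level_decompose:
  assumes f: "level d (f :: 'f \<Rightarrow> 'c)" and R: "finite R" "cball 0 (1 / d) = (\<Union>a\<in>R. cball (a::'f) d)"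
    "disjoint_family_on (\<lambda>a. cball a d) R"
  shows "f y = (\<Sum>a\<in>R. f a * indicator (cball 0 d) (y - a))"
proof -
  have iff: "y - a \<in> cball 0 d \<longleftrightarrow> y \<in> cball a d" for a by (simp add: dist_vabs_swap)
  show ?thesis
  proof (cases "y \<in> cball 0 (1 / d)")
    case True
    then obtain a where a: "a \<in> R" "y \<in> cball a d" using R(2) by auto
    have "y \<notin> cball b d" if "b \<in> R - {a}" for b
      using R(3) a that unfolding disjoint_family_on_def by blast
    then have "(\<Sum>b\<in>R - {a}. f b * indicator (cball 0 d) (y - b)) = 0"
      using iff by (intro sum.neutral) (auto simp: indicator_def)
    then have "(\<Sum>b\<in>R. f b * indicator (cball 0 d) (y - b)) = f a * indicator (cball 0 d) (y - a)"
      using sum.remove[OF R(1) a(1), of "\<lambda>b. f b * indicator (cball 0 d) (y - b)"] by simp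
    moreover have "f a = f y" using f a(2) unfolding level_def by (metis mem_cball)
    ultimately show ?thesis using a(2) iff[of a] by (simp add: indicator_def)
  next
    case False
    then have "f y = 0" using f by (auto simp: level_def dist_vabs_swap)
    moreover have "indicator (cball 0 d) (y - a) = (0::'c)" if "a \<in> R" for a
      using False R(2) that iff[of a] by (auto simp: indicator_def)
    ultimately show ?thesis by simp
  qed
qed

lemma schwartz_bounded:
  assumes "schwartz f"
  obtains s where "s \<ge> 0" "\<And>x. vabs (f x) \<le> s"
proof -
  obtain d where d: "level d f" using assms unfolding schwartz_def by blast
  have d01: "0 < d" "d \<le> 1" using d by (auto simp: level_def)
  obtain R where R: "finite R" "cball 0 (1 / d) = (\<Union>a\<in>R. cball (a::'f) d)"
    "disjoint_family_on (\<lambda>a. cball a d) R" using ex_representatives[OF d01] by blast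
  define s where "s = (\<Sum>a\<in>R. vabs (f a))"
  have s: "s \<ge> 0" by (simp add: s_def sum_nonneg)
  have "vabs (f x) \<le> s" for x
    unfolding level_decompose[OF d R, of x]
  proof (rule vabs_sum_le[OF _ s])
    fix a assume "a \<in> R"
    then have "vabs (f a) \<le> s" unfolding s_def using R(1) by (intro member_le_sum) auto
    then show "vabs (f a * indicator (cball 0 d) (x - a)) \<le> s" using s by (auto simp: indicator_def)
  qed
  then show ?thesis using that s by blast
qed

text \<open>Splitting \<open>f\<close> into translates of one small ball transfers the approximation of indicators to \<open>f\<close>.\<close>

lemma ex_approx_step:
  obtains r :: real where "0 \<le> r" "r < 1"
    "\<And>f s \<epsilon>. schwartz f \<Longrightarrow> (\<And>x. vabs (f x) \<le> s) \<Longrightarrow> \<epsilon> > 0 \<Longrightarrow>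
       \<exists>g. schwartz g \<and> (\<forall>y. vabs (f y - g y) \<le> r * s) \<and> (\<forall>x. vabs (fourier g x) \<le> \<epsilon>)"
proof -
  have p1: "real p > 1" using p_gt_1 by simp
  obtain r :: real where r: "0 \<le> r" "r < 1" and approx:
    "\<And>n \<epsilon>. \<epsilon> > 0 \<Longrightarrow> \<exists>g. schwartz g \<and> (\<forall>y. vabs (indicator (cball 0 ((1 / p) ^ n)) y - g y) \<le> r) \<and>
       (\<forall>x. vabs (fourier g x) \<le> \<epsilon>)"
    using ex_approx_indicator by blast
  have step: "\<exists>g. schwartz g \<and> (\<forall>y. vabs (f y - g y) \<le> r * s) \<and> (\<forall>x. vabs (fourier g x) \<le> \<epsilon>)"
    if f: "schwartz f" and s: "\<And>x. vabs (f x) \<le> s" and \<epsilon>: "\<epsilon> > 0" for f :: "'f \<Rightarrow> 'c" and s \<epsilon> :: real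
  proof -
    have s0: "s \<ge> 0" using s[of 0] vabs_nonneg[of "f 0"] by linarith
    obtain d\<^sub>0 where d0: "level d\<^sub>0 f" using f unfolding schwartz_def by blast
    then obtain n where n: "(1 / p) ^ n < d\<^sub>0"
      using real_arch_pow_inv[of d\<^sub>0 "1 / p"] p1 by (auto simp: level_def)
    define d where "d = (1 / real p) ^ n"
    have d: "level d f" using level_mono[OF d0, of d] n p1 by (simp add: d_def)
    have d01: "0 < d" "d \<le> 1" using d by (auto simp: level_def)
    obtain R where R: "finite R" "cball 0 (1 / d) = (\<Union>a\<in>R. cball (a::'f) d)"
      "disjoint_family_on (\<lambda>a. cball a d) R" using ex_representatives[OF d01] by blast
    \<comment> \<open>The values \<open>f a\<close> enlarge the transform by at most
      \<open>s\<close>; adding 1 covers the case \<open>s = 0\<close>.\<close>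
    have "\<epsilon> / (s + 1) > 0" using \<epsilon> s0 by simp
    from approx[OF this, of n] obtain h where h: "schwartz h"
      "\<And>y. vabs (indicator (cball 0 d) y - h y) \<le> r" "\<And>x. vabs (fourier h x) \<le> \<epsilon> / (s + 1)"
      unfolding d_def by blast
    define g where "g y = (\<Sum>a\<in>R. f a * h (y - a))" for y
    have ha: "schwartz (\<lambda>y. f a * h (y - a))" for a
      by (intro schwartz_mult_const schwartz_translate h(1))
    have "schwartz g" unfolding g_def by (intro schwartz_sum ha)
    moreover have "vabs (f y - g y) \<le> r * s" for y
    proof -
      have "f y - g y = (\<Sum>a\<in>R. f a * (indicator (cball 0 d) (y - a) - h (y - a)))"
        unfolding level_decompose[OF d R, of y] g_def by (simp add: sum_subtractf right_diff_distrib)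
      moreover have "vabs (f a * (indicator (cball 0 d) (y - a) - h (y - a))) \<le> r * s" for a
        unfolding vabs_mult mult.commute[of r] using s h(2) s0 by (intro mult_mono) auto
      then have "vabs (\<Sum>a\<in>R. f a * (indicator (cball 0 d) (y - a) - h (y - a))) \<le> r * s"
        using s0 r(1) by (intro vabs_sum_le) simp_all
      ultimately show ?thesis by simp
    qed
    moreover have "vabs (fourier g x) \<le> \<epsilon>" for x
    proof -
      have "fourier g x = (\<Sum>a\<in>R. f a * (\<psi> (x * a) * fourier h x))"
        unfolding g_def fourier_sum[OF ha]
        by (simp add: fourier_mult_const[OF schwartz_translate[OF h(1)]] fourier_translate[OF h(1)])
      moreover have "vabs (f a * (\<psi> (x * a) * fourier h x)) \<le> \<epsilon>" for a
      proof -
        have "vabs (f a * (\<psi> (x * a) * fourier h x)) = vabs (f a) * vabs (fourier h x)"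
          by (simp add: vabs_mult)
        also have "\<dots> \<le> (s + 1) * (\<epsilon> / (s + 1))"
          using s[of a] h(3) s0 by (intro mult_mono) auto
        finally show ?thesis using s0 by simp
      qed
      then have "vabs (\<Sum>a\<in>R. f a * (\<psi> (x * a) * fourier h x)) \<le> \<epsilon>"
        using \<epsilon> by (intro vabs_sum_le) simp_all
      ultimately show ?thesis by simp
    qed
    ultimately show ?thesis by blast
  qed
  show ?thesis by (rule that[OF r step])
qed

text \<open>Starting from 0, approximate the remaining error \<open>f - g\<close> again and again.
  Each round gains a factor \<open>r < 1\<close>, while by the ultrametric inequality the transforms
  of the sums never exceed the common tolerance. The \<open>k\<close>-th approximant uses
  \<open>k\<close> rounds with tolerance \<open>1 / Suc k\<close>.\<close>

theorem ex_small_fourier_approximation: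
  assumes f: "schwartz f"
  obtains \<Phi> where "\<And>n. schwartz (\<Phi> n)"
    "\<And>e. e > 0 \<Longrightarrow> \<forall>\<^sub>F n in sequentially. \<forall>x. vabs (\<Phi> n x - f x) \<le> e"
    "\<And>e. e > 0 \<Longrightarrow> \<forall>\<^sub>F n in sequentially. \<forall>x. vabs (fourier (\<Phi> n) x) \<le> e"
proof -
  obtain s where s: "s \<ge> 0" "\<And>x. vabs (f x) \<le> s" using schwartz_bounded[OF f] by blast
  obtain r :: real where r: "0 \<le> r" "r < 1" and step:
    "\<And>f s \<epsilon>. schwartz f \<Longrightarrow> (\<And>x. vabs (f x) \<le> s) \<Longrightarrow> \<epsilon> > 0 \<Longrightarrow>
       \<exists>g. schwartz g \<and> (\<forall>y. vabs (f y - g y) \<le> r * s) \<and> (\<forall>x. vabs (fourier g x) \<le> \<epsilon>)"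
    using ex_approx_step by blast
  have "\<exists>g. schwartz g \<and> (\<forall>y. vabs (f y - g y) \<le> r ^ k * s) \<and> (\<forall>x. vabs (fourier g x) \<le> \<epsilon>)"
    if \<epsilon>: "\<epsilon> > 0" for k and \<epsilon> :: real
  proof (induction k)
    case 0
    show ?case using s schwartz_zero \<epsilon> by (intro exI[of _ "\<lambda>_. 0"]) (simp add: fourier_zero)
  next
    case (Suc k)
    then obtain g where g: "schwartz g" "\<And>y. vabs (f y - g y) \<le> r ^ k * s" "\<And>x. vabs (fourier g x) \<le> \<epsilon>"
      by blast
    obtain g' where g': "schwartz g'" "\<And>y. vabs ((f y - g y) - g' y) \<le> r * (r ^ k * s)"
      "\<And>x. vabs (fourier g' x) \<le> \<epsilon>"
      using step[OF schwartz_diff[OF f g(1)] g(2) \<epsilon>] by blast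
    have "vabs (fourier (\<lambda>y. g y + g' y) x) \<le> \<epsilon>" for x
      unfolding fourier_add[OF g(1) g'(1)] using g(3) g'(3) by (intro vabs_add_le)
    moreover have "vabs (f y - (g y + g' y)) \<le> r ^ Suc k * s" for y
      using g'(2)[of y] by (simp add: algebra_simps)
    ultimately show ?case using schwartz_add[OF g(1) g'(1)]
      by (intro exI[of _ "\<lambda>y. g y + g' y"]) blast
  qed
  then have "\<exists>g. schwartz g \<and> (\<forall>y. vabs (f y - g y) \<le> r ^ k * s) \<and>
    (\<forall>x. vabs (fourier g x) \<le> 1 / real (Suc k))" for k by simp
  then obtain \<Phi> where \<Phi>: "\<And>k. schwartz (\<Phi> k)" "\<And>k y. vabs (f y - \<Phi> k y) \<le> r ^ k * s"
    "\<And>k x. vabs (fourier (\<Phi> k) x) \<le> 1 / real (Suc k)"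
    by metis
  show ?thesis
  proof (rule that[OF \<Phi>(1)])
    fix e :: real assume e: "e > 0"
    have "(\<lambda>k. r ^ k * s) \<longlonglongrightarrow> 0 * s" using r by (intro tendsto_mult_right LIMSEQ_power_zero) simp
    then have "\<forall>\<^sub>F k in sequentially. r ^ k * s < e" using e by (intro order_tendstoD(2)) auto
    then show "\<forall>\<^sub>F k in sequentially. \<forall>x. vabs (\<Phi> k x - f x) \<le> e"
      by eventually_elim (metis \<Phi>(2) vabs_minus_commute less_imp_le order_trans)
    have "(\<lambda>k. 1 / real (Suc k)) \<longlonglongrightarrow> 0" by (rule LIMSEQ_Suc[OF lim_1_over_n])
    then have "\<forall>\<^sub>F k in sequentially. 1 / real (Suc k) < e" using e by (intro order_tendstoD(2)) auto
    then show "\<forall>\<^sub>F k in sequentially. \<forall>x. vabs (fourier (\<Phi> k) x) \<le> e"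
      by eventually_elim (metis \<Phi>(3) less_imp_le order_trans)
  qed
qed

end

section \<open>Extensions of the \<open>p\<close>-adic numbers\<close>

text \<open>The embedding fixes the natural numbers, so the value is that of
  \<open>rat_padic_abs\<close> at \<open>p\<close>.\<close>

lemma vabs_prime_padic:
  assumes "prime p" "is_padic_field p TYPE('q::{nonarch_valued_field, field_char_0})"
    and "valued_field_embedding (\<iota> :: 'q \<Rightarrow> 'l::nonarch_valued_field)"
  shows "vabs (of_nat p :: 'l) = 1 / p"
proof -
  have p1: "p > 1" using assms(1) by (rule prime_gt_1_nat)
  have "\<iota> 0 + \<iota> 0 = \<iota> 0" using assms(3) unfolding valued_field_embedding_def by (metis add_0)
  then have 0: "\<iota> 0 = 0" by (simp only: add_cancel_left_right)
  have nat: "\<iota> (of_nat n) = of_nat n" for n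
    by (induction n) (use assms(3) 0 in \<open>simp_all add: valued_field_embedding_def\<close>)
  have "vabs (of_nat p :: 'l) = vabs (of_nat p :: 'q)"
    using assms(3) nat[of p] unfolding valued_field_embedding_def by metis
  also have "\<dots> = rat_padic_abs p (of_nat p)"
    using assms(2) unfolding is_padic_field_def by (metis of_rat_of_nat_eq)
  also have "\<dots> = 1 / p"
  proof -
    have "quotient_of (of_nat p) = (int p, 1)"
      using quotient_of_int[of "int p"] by (metis Rat.of_int_def of_int_of_nat_eq)
    moreover have "multiplicity (int p) (int p) = 1"
      using p1 assms(1) by (intro multiplicity_self) auto
    ultimately show ?thesis using p1 by (simp add: rat_padic_abs_def power_int_minus divide_inverse)
  qed
  finally show ?thesis .
qed

text \<open>The compact closed support of a function that is nonzero at \<open>x\<close> contains a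
  ball around \<open>x\<close>, and the ring of integers is a closed subset of a rescaled copy of
  that ball.\<close>

lemma compact_integers_of_schwartz:
  fixes \<phi> :: "'f::nonarch_valued_field \<Rightarrow> 'c::nonarch_valued_field"
  assumes \<phi>: "\<phi> \<in> schwartz_space" "\<phi> x \<noteq> 0" and p: "p > 1" "vabs (of_nat p :: 'f) = 1 / p"
  shows "compact (ring_of_integers :: 'f set)"
proof -
  obtain U where U: "open U" "x \<in> U" "\<phi> constant_on U"
    using \<phi>(1) unfolding schwartz_space_def loc_const_def by blast
  then obtain e where e: "e > 0" "cball x e \<subseteq> U" using open_contains_cball by blast
  have "\<phi> y \<noteq> 0" if "y \<in> U" for y using U \<phi>(2) that unfolding constant_on_def by metis
  then have "cball x e \<subseteq> {x. \<phi> x \<noteq> 0}" using e(2) by auto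
  then have "cball x e \<subseteq> closure {x. \<phi> x \<noteq> 0}" by (rule order_trans[OF _ closure_subset])
  moreover have "compact (closure {x. \<phi> x \<noteq> 0})" using \<phi>(1) by (simp add: schwartz_space_def)
  ultimately have comp: "compact (cball x e)"
    by (metis closed_cball compact_Int_closed inf.absorb_iff2)
  obtain k where k: "(1 / p) ^ k < e" using real_arch_pow_inv[OF e(1), of "1 / p"] p(1) by auto
  define u where "u = (of_nat p ^ k :: 'f)"
  have u: "vabs u < e" using k by (simp add: u_def vabs_power p(2))
  have "of_nat p \<noteq> (0::'f)"
  proof
    assume "of_nat p = (0::'f)"
    then have "1 / real p = 0" using p(2) by simp
    then show False using p(1) by simp
  qed
  then have u0: "u \<noteq> 0" by (simp add: u_def)
  have "ring_of_integers \<subseteq> (\<lambda>y. - x / u + 1 / u * y) ` cball x e"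
  proof
    fix z :: 'f assume "z \<in> ring_of_integers"
    then have "vabs u * vabs z \<le> vabs u * 1" by (intro mult_left_mono) (auto simp: ring_of_integers_def)
    then have "x + u * z \<in> cball x e" using u by (simp add: dist_vabs_swap vabs_mult)
    then have "- x / u + 1 / u * (x + u * z) \<in> (\<lambda>y. - x / u + 1 / u * y) ` cball x e" by (rule imageI)
    moreover have "- x / u + 1 / u * (x + u * z) = z" using u0 by (simp add: field_simps)
    ultimately show "z \<in> (\<lambda>y. - x / u + 1 / u * y) ` cball x e" by simp
  qed
  then have "ring_of_integers = (\<lambda>y. - x / u + 1 / u * y) ` cball x e \<inter> cball 0 1"
    unfolding ring_of_integers_eq_cball by blast
  moreover have "compact \<dots>"
    by (intro compact_Int_closed compact_affine_image comp closed_cball)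
  ultimately show ?thesis by simp
qed

section \<open>Convergence in the sup norm and conclusion\<close>

lemma sup_norm_bounds:
  assumes "\<And>x. vabs (h x) \<le> B"
  shows "0 \<le> sup_norm h" "sup_norm h \<le> B"
proof -
  have "bdd_above (range (\<lambda>x. vabs (h x)))" using assms by (intro bdd_aboveI[where M = B]) auto
  \<comment> \<open>\<open>undefined\<close> is just some point of the domain; the pointwise bound
    is what makes the real supremum meaningful.\<close>
  then have "vabs (h undefined) \<le> sup_norm h" unfolding sup_norm_def by (intro cSUP_upper) auto
  then show "0 \<le> sup_norm h" using vabs_nonneg[of "h undefined"] by linarith
  show "sup_norm h \<le> B" unfolding sup_norm_def using assms by (intro cSUP_least) auto
qed

lemma sup_norm_tendsto_zero:
  assumes "\<And>e. e > 0 \<Longrightarrow> \<forall>\<^sub>F n in sequentially. \<forall>x. vabs (h n x) \<le> e"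
  shows "(\<lambda>n. sup_norm (h n)) \<longlonglongrightarrow> 0"
proof (rule tendstoI)
  fix e :: real assume "e > 0"
  then have "\<forall>\<^sub>F n in sequentially. \<forall>x. vabs (h n x) \<le> e / 2" by (intro assms) simp
  then show "\<forall>\<^sub>F n in sequentially. dist (sup_norm (h n)) 0 < e"
  proof eventually_elim
    case (elim n)
    then show ?case using sup_norm_bounds[of "h n" "e / 2"] \<open>e > 0\<close> by (simp add: dist_real_def)
  qed
qed

theorem theorem1:
  fixes p :: nat
    and \<iota> :: "'q::{nonarch_valued_field, field_char_0} \<Rightarrow> 'f::nonarch_valued_field"
    and \<kappa> :: "'q \<Rightarrow> 'c::{nonarch_valued_field, alg_closed_field}"
    and \<psi> :: "'f \<Rightarrow> 'c"
    and \<mu> :: "'f set \<Rightarrow> 'c"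
    and \<phi> :: "'f \<Rightarrow> 'c"
  assumes "prime p"
    and "is_padic_field p TYPE('q)"
    and "finite_valued_extension \<iota>"
    and "valued_algebraic_closure \<kappa>"
    and "additive_character \<psi>"
    and "annihilator \<psi> ring_of_integers = ring_of_integers"
    and "normalized_haar_distribution \<mu>"
    and "\<phi> \<in> schwartz_space"
  shows "\<exists>\<Phi> :: nat \<Rightarrow> 'f \<Rightarrow> 'c.
           (\<forall>n. \<Phi> n \<in> schwartz_space) \<and>
           (\<lambda>n. sup_norm (\<lambda>x. \<Phi> n x - \<phi> x)) \<longlonglongrightarrow> 0 \<and>
           (\<lambda>n. sup_norm (fourier_transform \<mu> \<psi> (\<Phi> n))) \<longlonglongrightarrow> 0"
proof (cases "\<exists>x. \<phi> x \<noteq> 0")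
  case False
  then have "\<phi> = (\<lambda>_. 0)" by auto
  moreover have "fourier_transform \<mu> \<psi> (\<lambda>_. 0) = (\<lambda>_. 0)"
    by (simp add: fourier_transform_def distr_integral_def fun_eq_iff)
  moreover have "sup_norm (\<lambda>_::'f. 0::'c) = 0" by (simp add: sup_norm_def)
  ultimately show ?thesis using assms(8) by (intro exI[of _ "\<lambda>_. \<phi>"]) simp
next
  case True
  then obtain x where x: "\<phi> x \<noteq> 0" by blast
  have vF: "vabs (of_nat p :: 'f) = 1 / p"
    using vabs_prime_padic[OF assms(1,2)] assms(3) unfolding finite_valued_extension_def by blast
  have vC: "vabs (of_nat p :: 'c) = 1 / p"
    using vabs_prime_padic[OF assms(1,2)] assms(4) unfolding valued_algebraic_closure_def by blast
  \<comment> \<open>Here the nonzero value of \<open>\<phi>\<close> at \<open>x\<close> supplies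
    compactness of the ring of integers, which is why \<open>\<phi> = 0\<close> was treated
    separately.\<close>
  interpret padic_fourier p \<psi> \<mu>
    using assms(1,5-7) vF vC compact_integers_of_schwartz[OF assms(8) x prime_gt_1_nat[OF assms(1)] vF]
    by unfold_locales
  have "schwartz \<phi>" using assms(8) schwartz_space_iff by blast
  then obtain \<Phi> where \<Phi>: "\<And>n. schwartz (\<Phi> n)"
    "\<And>e. e > 0 \<Longrightarrow> \<forall>\<^sub>F n in sequentially. \<forall>x. vabs (\<Phi> n x - \<phi> x) \<le> e"
    "\<And>e. e > 0 \<Longrightarrow> \<forall>\<^sub>F n in sequentially. \<forall>x. vabs (fourier_transform \<mu> \<psi> (\<Phi> n) x) \<le> e"
    using ex_small_fourier_approximation by blast
  show ?thesis
  proof (intro exI[of _ \<Phi>] conjI allI)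
    show "\<Phi> n \<in> schwartz_space" for n using \<Phi>(1) by (simp add: schwartz_space_iff)
    show "(\<lambda>n. sup_norm (\<lambda>x. \<Phi> n x - \<phi> x)) \<longlonglongrightarrow> 0"
      by (rule sup_norm_tendsto_zero) (rule \<Phi>(2))
    show "(\<lambda>n. sup_norm (fourier_transform \<mu> \<psi> (\<Phi> n))) \<longlonglongrightarrow> 0"
      by (rule sup_norm_tendsto_zero) (rule \<Phi>(3))
  qed
qed

end
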